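(* Let $0<\varepsilon<\infty$, $0<s<\infty$ and $0<\ell<\infty$. Let $\{B_t\}_{t\ge0}$ and $\{N_t\}_{t\ge0}$ be two independent standard Wiener processes, and define $X_0=0$, $X_t=B_t+st$ and $Y_0=0$, $Y_t=X_t+\varepsilon N_t$ for real $t>0$. Let $\tau_\ell=\inf\{t\ge 0: X_t\ge \ell\}$, let $\hat X_0=0$, $\hat X_t=st+\frac{1}{1+\varepsilon^2}(Y_t-st)$ for $t>0$, and let $\eta^*_\ell=\inf\{t\ge 0:\hat X_t\ge \ell\}$. Then $$ \mathbb{E}|\eta^*_\ell-\tau_\ell| \leq \sqrt{\frac{2\ell\varepsilon^{2}}{\pi(1+\varepsilon^2)s^3}}+\sqrt{\frac{36\varepsilon^2}{(1+\varepsilon^2)s^2}}\left(\frac{\ell}{2\pi s^3}\right)^{1/4}. $$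
   Context: Time $t$ is continuous, ranging over $[0,\infty)$. Standard Wiener processes start at $0$. *)

theory Defs
  imports "HOL-Probability.Probability"
begin

text \<open>Processes are indexed by \<open>real\<close>; only their values at times \<open>t \<ge> 0\<close> matter.
  The initial value and path continuity are required almost surely, which covers the
  convention that they hold at every sample point.\<close>

locale standard_wiener_process = prob_space M
  for M :: "'a measure" +
  fixes W :: "real \<Rightarrow> 'a \<Rightarrow> real"
  assumes random_variable_W: "\<And>t. 0 \<le> t \<Longrightarrow> random_variable borel (W t)"
    and start_at_zero: "AE \<omega> in M. W 0 \<omega> = 0"
    and indep_increments:
      "\<And>(n::nat) (t::nat \<Rightarrow> real). 0 \<le> t 0 \<Longrightarrow> (\<And>i. i < n \<Longrightarrow> t i < t (Suc i)) \<Longrightarrow>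
         indep_vars (\<lambda>_. borel) (\<lambda>i \<omega>. W (t (Suc i)) \<omega> - W (t i) \<omega>) {..<n}"
    and normal_increments:
      "\<And>u v. 0 \<le> u \<Longrightarrow> u < v \<Longrightarrow>
         distributed M lborel (\<lambda>\<omega>. W v \<omega> - W u \<omega>) (normal_density 0 (sqrt (v - u)))"
    and continuous_paths: "AE \<omega> in M. continuous_on {0..} (\<lambda>t. W t \<omega>)"

text \<open>Independence of the two processes as random elements of the path space
  \<open>\<real>\<^bsup>[0,\<infinity>)\<^esup>\<close> with the product sigma-algebra, i.e. independence of the sigma-algebras
  generated by all the \<open>V t\<close> and by all the \<open>W t\<close>, \<open>t \<ge> 0\<close>.\<close>

definition indep_processes ::
    "'a measure \<Rightarrow> (real \<Rightarrow> 'a \<Rightarrow> real) \<Rightarrow> (real \<Rightarrow> 'a \<Rightarrow> real) \<Rightarrow> bool" where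
  "indep_processes M V W \<longleftrightarrow>
     prob_space.indep_var M
       (PiM {0..} (\<lambda>_. borel)) (\<lambda>\<omega>. \<lambda>t\<in>{0..}. V t \<omega>)
       (PiM {0..} (\<lambda>_. borel)) (\<lambda>\<omega>. \<lambda>t\<in>{0..}. W t \<omega>)"

definition drifted_process :: "real \<Rightarrow> (real \<Rightarrow> 'a \<Rightarrow> real) \<Rightarrow> real \<Rightarrow> 'a \<Rightarrow> real" where
  "drifted_process s B t \<omega> = (if t = 0 then 0 else B t \<omega> + s * t)"

definition noisy_process ::
    "real \<Rightarrow> (real \<Rightarrow> 'a \<Rightarrow> real) \<Rightarrow> (real \<Rightarrow> 'a \<Rightarrow> real) \<Rightarrow> real \<Rightarrow> 'a \<Rightarrow> real" where
  "noisy_process \<epsilon> X N t \<omega> = (if t = 0 then 0 else X t \<omega> + \<epsilon> * N t \<omega>)"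

definition estimated_process ::
    "real \<Rightarrow> real \<Rightarrow> (real \<Rightarrow> 'a \<Rightarrow> real) \<Rightarrow> real \<Rightarrow> 'a \<Rightarrow> real" where
  "estimated_process \<epsilon> s Y t \<omega> =
     (if t = 0 then 0 else s * t + 1 / (1 + \<epsilon>\<^sup>2) * (Y t \<omega> - s * t))"

text \<open>The infimum is taken in \<open>ereal\<close>, so the passage time is \<open>\<infinity>\<close> if the level is never
  reached.\<close>

definition first_passage_time :: "real \<Rightarrow> (real \<Rightarrow> 'a \<Rightarrow> real) \<Rightarrow> 'a \<Rightarrow> ereal" where
  "first_passage_time l Z \<omega> = (INF t\<in>{t. 0 \<le> t \<and> Z t \<omega> \<ge> l}. ereal t)"

end

theory Submission
  imports Defs "HOL-Real_Asymp.Real_Asymp"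
begin

text \<open>Write \<open>X = Xhat + V\<close>. By rotation invariance of the Gaussian, \<open>Xhat\<close> and \<open>V\<close> are independent, and
  \<open>V\<close> is a Wiener process scaled by \<open>c = \<epsilon> / sqrt (1 + \<epsilon>\<^sup>2)\<close>. Wald's identity gives
  \<open>E \<eta> = E \<tau> = l / s\<close>, hence \<open>E \<bar>\<eta> - \<tau>\<bar> = 2 E (\<tau> - \<eta>)\<^sup>+\<close>. After \<open>\<eta>\<close>, where \<open>X = l + V\<close>, the drift
  needs expected time at most \<open>E V\<^sup>- / s\<close> to bring \<open>X\<close> back to \<open>l\<close>, and by independence
  \<open>E V\<^sup>-\<close> at time \<open>\<eta>\<close> is \<open>c E (sqrt \<eta>) / sqrt (2 pi) \<le> c sqrt (l / (2 pi s))\<close>. This already yields the first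
  summand of the bound. The argument is carried out for random
  walks on a grid, truncated at a finite horizon, where optional stopping is elementary and the overshoot
  is controlled by fourth moments; Fatou's lemma transfers the estimate to continuous time.\<close>

section \<open>Rotation of independent Gaussian families\<close>

text \<open>The weight \<open>1 / (1 + \<epsilon>\<^sup>2)\<close> is the regression coefficient of
  \<open>B\<close> on \<open>B + \<epsilon> * N\<close>, the one weight for which the error
  \<open>V\<close> is uncorrelated with \<open>Xhat\<close>. Independence makes the error at
  \<open>\<eta>\<close> computable: given \<open>\<eta> = t\<close> it is still centred normal with
  variance \<open>c\<^sup>2 * t\<close>. The strong Markov property is avoided. Instead of
  restarting the signal at \<open>\<eta>\<close>, Wald's identity is applied at the maximum of the
  two grid passage times \<open>T\<close> (of the estimate) and \<open>S\<close> (of the signal), a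
  stopping time of the joint filtration, and \<open>\<bar>T - S\<bar> = 2 * max S T - T - S\<close>
  turns the absolute difference into three means. One-sided bounds then suffice: an upper one for
  the mean of \<open>T\<close>, a lower one for the mean of \<open>S\<close>. The finite horizon is
  paid for only in the latter, because \<open>T < S\<close> already excludes that \<open>T\<close>
  was cut off by the horizon.\<close>

lemma (in prob_space) indep_vars_bool_Times_if_indep_families:
  assumes I: "finite I" "I \<noteq> {}"
    and X: "indep_vars (\<lambda>_. N) X I" and Y: "indep_vars (\<lambda>_. N) Y I"
    and XY: "indep_var (PiM I (\<lambda>_. N)) (\<lambda>\<omega>. \<lambda>i\<in>I. X i \<omega>) (PiM I (\<lambda>_. N)) (\<lambda>\<omega>. \<lambda>i\<in>I. Y i \<omega>)"
  shows "indep_vars (\<lambda>_. N) (\<lambda>(b, i). if b then X i else Y i) (UNIV \<times> I)"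
proof (subst indep_vars_finite[where E="\<lambda>_. sets N"])
  show "(UNIV :: bool set) \<times> I \<noteq> {}" "finite ((UNIV :: bool set) \<times> I)"
    using I by auto
  show "random_variable N (case j of (b, i) \<Rightarrow> if b then X i else Y i)" if "j \<in> UNIV \<times> I" for j
    using X Y that by (auto simp: indep_vars_def)
  let ?Z = "\<lambda>(b, i). if b then X i else Y i"
  show "\<forall>A\<in>UNIV \<times> I \<rightarrow> sets N.
      prob (\<Inter>j\<in>UNIV \<times> I. ?Z j -` A j \<inter> space M) = (\<Prod>j\<in>UNIV \<times> I. prob (?Z j -` A j \<inter> space M))"
  proof
    fix A :: "bool \<times> 'b \<Rightarrow> 'c set" assume A: "A \<in> UNIV \<times> I \<rightarrow> sets N"
    let ?A = "\<lambda>b. Pi\<^sub>E I (\<lambda>i. A (b, i))"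
    \<comment> \<open>A cylinder event of the flattened family is the preimage of a product of two
      rectangles, so it factors across the two families first and then within each of them.\<close>
    have "(\<Inter>j\<in>UNIV \<times> I. ?Z j -` A j \<inter> space M) =
        (\<lambda>\<omega>. (\<lambda>i\<in>I. X i \<omega>, \<lambda>i\<in>I. Y i \<omega>)) -` (?A True \<times> ?A False) \<inter> space M"
      using I by (auto simp: PiE_iff UNIV_bool)
    also have "prob \<dots> = prob ((\<lambda>\<omega>. \<lambda>i\<in>I. X i \<omega>) -` ?A True \<inter> space M)
        * prob ((\<lambda>\<omega>. \<lambda>i\<in>I. Y i \<omega>) -` ?A False \<inter> space M)"
      using A I by (intro indep_varD[OF XY] sets_PiM_I_finite) auto
    also have "(\<lambda>\<omega>. \<lambda>i\<in>I. X i \<omega>) -` ?A True \<inter> space M = (\<Inter>i\<in>I. X i -` A (True, i) \<inter> space M)"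
      using I by (auto simp: PiE_iff)
    also have "prob \<dots> = (\<Prod>i\<in>I. prob (X i -` A (True, i) \<inter> space M))"
      using A I by (intro indep_varsD_finite[OF X]) auto
    also have "(\<lambda>\<omega>. \<lambda>i\<in>I. Y i \<omega>) -` ?A False \<inter> space M = (\<Inter>i\<in>I. Y i -` A (False, i) \<inter> space M)"
      using I by (auto simp: PiE_iff)
    also have "prob \<dots> = (\<Prod>i\<in>I. prob (Y i -` A (False, i) \<inter> space M))"
      using A I by (intro indep_varsD_finite[OF Y]) auto
    finally show "prob (\<Inter>j\<in>UNIV \<times> I. ?Z j -` A j \<inter> space M) = (\<Prod>j\<in>UNIV \<times> I. prob (?Z j -` A j \<inter> space M))"
      by (simp add: prod.cartesian_product' UNIV_bool mult.commute)
  qed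
qed (auto simp: sets.sigma_sets_eq sets.Int_stable sets.space_closed Pow_def dest: sets.sets_into_space)

text \<open>The same array of variables, grouped the other way: across indices first and across the
  two labels last. Together the two criteria allow regrouping: the array arises row by row from two
  independent processes, is rotated column by column, and is then flattened again.\<close>

lemma (in prob_space) indep_vars_bool_Times_if_indep_pairs:
  assumes I: "finite I" "I \<noteq> {}"
    and XY: "indep_vars (\<lambda>_. N \<Otimes>\<^sub>M N) (\<lambda>i \<omega>. (X i \<omega>, Y i \<omega>)) I"
    and pair: "\<And>i. i \<in> I \<Longrightarrow> indep_var N (X i) N (Y i)"
  shows "indep_vars (\<lambda>_. N) (\<lambda>(b, i). if b then X i else Y i) (UNIV \<times> I)"
proof (subst indep_vars_finite[where E="\<lambda>_. sets N"])
  show "(UNIV :: bool set) \<times> I \<noteq> {}" "finite ((UNIV :: bool set) \<times> I)"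
    using I by auto
  show "random_variable N (case j of (b, i) \<Rightarrow> if b then X i else Y i)" if "j \<in> UNIV \<times> I" for j
    using pair[THEN indep_var_rv1] pair[THEN indep_var_rv2] that by auto
  let ?Z = "\<lambda>(b, i). if b then X i else Y i"
  show "\<forall>A\<in>UNIV \<times> I \<rightarrow> sets N.
      prob (\<Inter>j\<in>UNIV \<times> I. ?Z j -` A j \<inter> space M) = (\<Prod>j\<in>UNIV \<times> I. prob (?Z j -` A j \<inter> space M))"
  proof
    fix A :: "bool \<times> 'b \<Rightarrow> 'c set" assume A: "A \<in> UNIV \<times> I \<rightarrow> sets N"
    let ?A = "\<lambda>i. A (True, i) \<times> A (False, i)"
    have "(\<Inter>j\<in>UNIV \<times> I. ?Z j -` A j \<inter> space M) = (\<Inter>i\<in>I. (\<lambda>\<omega>. (X i \<omega>, Y i \<omega>)) -` ?A i \<inter> space M)"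
      using I by (auto simp: UNIV_bool)
    also have "prob \<dots> = (\<Prod>i\<in>I. prob ((\<lambda>\<omega>. (X i \<omega>, Y i \<omega>)) -` ?A i \<inter> space M))"
      using A I by (intro indep_varsD_finite[OF XY]) auto
    also have "\<dots> = (\<Prod>i\<in>I. prob (X i -` A (True, i) \<inter> space M) * prob (Y i -` A (False, i) \<inter> space M))"
      using A by (intro prod.cong indep_varD[OF pair]) auto
    finally show "prob (\<Inter>j\<in>UNIV \<times> I. ?Z j -` A j \<inter> space M) = (\<Prod>j\<in>UNIV \<times> I. prob (?Z j -` A j \<inter> space M))"
      by (simp add: prod.cartesian_product' UNIV_bool mult.commute prod.distrib)
  qed
qed (auto simp: sets.sigma_sets_eq sets.Int_stable sets.space_closed Pow_def dest: sets.sets_into_space)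

section \<open>Rotating a pair of independent centred normal variables\<close>

lemma normal_density_rotation:
  fixes \<epsilon> \<sigma> p r :: real
  assumes "0 < \<epsilon>" "0 < \<sigma>"
  shows "(1 + \<epsilon>\<^sup>2) / \<epsilon> * (normal_density 0 \<sigma> (p + r) * normal_density 0 \<sigma> (\<epsilon> * p - r / \<epsilon>)) =
    normal_density 0 (\<sigma> / sqrt (1 + \<epsilon>\<^sup>2)) p * normal_density 0 (\<epsilon> * \<sigma> / sqrt (1 + \<epsilon>\<^sup>2)) r"
proof -
  have pos: "0 < 1 + \<epsilon>\<^sup>2"
    by (simp add: add_pos_nonneg)
  have 1: "exp (- (p + r)\<^sup>2 / (2 * \<sigma>\<^sup>2)) * exp (- (\<epsilon> * p - r / \<epsilon>)\<^sup>2 / (2 * \<sigma>\<^sup>2)) =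
      exp (- p\<^sup>2 / (2 * (\<sigma> / sqrt (1 + \<epsilon>\<^sup>2))\<^sup>2)) * exp (- r\<^sup>2 / (2 * (\<epsilon> * \<sigma> / sqrt (1 + \<epsilon>\<^sup>2))\<^sup>2))"
  proof -
    \<comment> \<open>The arguments \<open>p + r\<close> and
      \<open>\<epsilon> * p - r / \<epsilon>\<close> recover the original pair from the rotated one.
      The terms in \<open>p * r\<close> cancel, which is the source of independence. The factor
      \<open>(1 + \<epsilon>\<^sup>2) / \<epsilon>\<close> in the claim is the absolute Jacobian
      determinant of this substitution.\<close>
    have "(p + r)\<^sup>2 + (\<epsilon> * p - r / \<epsilon>)\<^sup>2 = p\<^sup>2 * (1 + \<epsilon>\<^sup>2) + r\<^sup>2 * ((1 + \<epsilon>\<^sup>2) / \<epsilon>\<^sup>2)"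
      using assms by (simp add: field_simps power2_eq_square)
    then have "- (p + r)\<^sup>2 / (2 * \<sigma>\<^sup>2) + - (\<epsilon> * p - r / \<epsilon>)\<^sup>2 / (2 * \<sigma>\<^sup>2) =
        - (p\<^sup>2 * (1 + \<epsilon>\<^sup>2) + r\<^sup>2 * ((1 + \<epsilon>\<^sup>2) / \<epsilon>\<^sup>2)) / (2 * \<sigma>\<^sup>2)"
      by (metis add_divide_distrib minus_add_distrib)
    also have "\<dots> = - p\<^sup>2 / (2 * (\<sigma> / sqrt (1 + \<epsilon>\<^sup>2))\<^sup>2) + - r\<^sup>2 / (2 * (\<epsilon> * \<sigma> / sqrt (1 + \<epsilon>\<^sup>2))\<^sup>2)"
    proof -
      have "- p\<^sup>2 / (2 * (\<sigma> / sqrt (1 + \<epsilon>\<^sup>2))\<^sup>2) = - (p\<^sup>2 * (1 + \<epsilon>\<^sup>2)) / (2 * \<sigma>\<^sup>2)"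
        "- r\<^sup>2 / (2 * (\<epsilon> * \<sigma> / sqrt (1 + \<epsilon>\<^sup>2))\<^sup>2) = - (r\<^sup>2 * ((1 + \<epsilon>\<^sup>2) / \<epsilon>\<^sup>2)) / (2 * \<sigma>\<^sup>2)"
        using pos by (simp_all add: power_divide power_mult_distrib)
      then show ?thesis
        by (metis add_divide_distrib minus_add_distrib)
    qed
    finally show ?thesis
      unfolding exp_add[symmetric] by simp
  qed
  have 2: "(1 + \<epsilon>\<^sup>2) / \<epsilon> * (1 / sqrt (2 * pi * \<sigma>\<^sup>2) * (1 / sqrt (2 * pi * \<sigma>\<^sup>2))) =
      1 / sqrt (2 * pi * (\<sigma> / sqrt (1 + \<epsilon>\<^sup>2))\<^sup>2) * (1 / sqrt (2 * pi * (\<epsilon> * \<sigma> / sqrt (1 + \<epsilon>\<^sup>2))\<^sup>2))"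
    using assms pos by (simp add: real_sqrt_mult power_divide power_mult_distrib real_sqrt_divide)
  have "(1 + \<epsilon>\<^sup>2) / \<epsilon> * (normal_density 0 \<sigma> (p + r) * normal_density 0 \<sigma> (\<epsilon> * p - r / \<epsilon>)) =
      ((1 + \<epsilon>\<^sup>2) / \<epsilon> * (1 / sqrt (2 * pi * \<sigma>\<^sup>2) * (1 / sqrt (2 * pi * \<sigma>\<^sup>2)))) *
      (exp (- (p + r)\<^sup>2 / (2 * \<sigma>\<^sup>2)) * exp (- (\<epsilon> * p - r / \<epsilon>)\<^sup>2 / (2 * \<sigma>\<^sup>2)))"
    by (simp add: normal_density_def)
  also have "\<dots> = normal_density 0 (\<sigma> / sqrt (1 + \<epsilon>\<^sup>2)) p * normal_density 0 (\<epsilon> * \<sigma> / sqrt (1 + \<epsilon>\<^sup>2)) r"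
    unfolding 1 2 by (simp add: normal_density_def)
  finally show ?thesis .
qed

text \<open>The planar change of variables is carried out one coordinate at a time:
  \<open>x = c * p - \<epsilon> * y\<close> with \<open>y\<close> fixed, an exchange of the
  integrals, then \<open>y = \<epsilon> * p - r / \<epsilon>\<close> with \<open>p\<close> fixed.
  The factors \<open>c\<close> and \<open>1 / \<epsilon>\<close> multiply to the Jacobian.\<close>

lemma nn_integral_normal_rotation:
  fixes \<epsilon> \<sigma> :: real
  assumes [arith]: "0 < \<epsilon>" and \<sigma>: "0 < \<sigma>"
    and [measurable]: "f \<in> borel_measurable (borel \<Otimes>\<^sub>M borel)"
  shows "(\<integral>\<^sup>+y. \<integral>\<^sup>+x. f ((x + \<epsilon> * y) / (1 + \<epsilon>\<^sup>2), (\<epsilon>\<^sup>2 * x - \<epsilon> * y) / (1 + \<epsilon>\<^sup>2)) *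
      ennreal (normal_density 0 \<sigma> x * normal_density 0 \<sigma> y) \<partial>lborel \<partial>lborel) =
    (\<integral>\<^sup>+p. \<integral>\<^sup>+r. f (p, r) * ennreal (normal_density 0 (\<sigma> / sqrt (1 + \<epsilon>\<^sup>2)) p *
      normal_density 0 (\<epsilon> * \<sigma> / sqrt (1 + \<epsilon>\<^sup>2)) r) \<partial>lborel \<partial>lborel)"
    (is "?L = ?R")
proof -
  define c where "c = 1 + \<epsilon>\<^sup>2"
  have [arith]: "0 < c"
    by (simp add: add_pos_nonneg c_def)
  let ?\<phi> = "normal_density 0 \<sigma>"
  have 1: "((- \<epsilon> * y + c * p) + \<epsilon> * y) / c = p" for p y
    by (simp add: field_simps)
  have "(\<epsilon>\<^sup>2 * (- \<epsilon> * y + c * p) - \<epsilon> * y) = c * (\<epsilon>\<^sup>2 * p - \<epsilon> * y)" for p y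
    unfolding c_def by (simp add: algebra_simps power2_eq_square)
  then have 2: "(\<epsilon>\<^sup>2 * (- \<epsilon> * y + c * p) - \<epsilon> * y) / c = \<epsilon>\<^sup>2 * p - \<epsilon> * y" for p y
    by simp
  have "?L = (\<integral>\<^sup>+y. c * (\<integral>\<^sup>+p. f (p, \<epsilon>\<^sup>2 * p - \<epsilon> * y) * ennreal (?\<phi> (- \<epsilon> * y + c * p) * ?\<phi> y) \<partial>lborel) \<partial>lborel)"
    unfolding c_def[symmetric]
  proof (rule nn_integral_cong)
    fix y
    show "(\<integral>\<^sup>+x. f ((x + \<epsilon> * y) / c, (\<epsilon>\<^sup>2 * x - \<epsilon> * y) / c) * ennreal (?\<phi> x * ?\<phi> y) \<partial>lborel) =
      c * (\<integral>\<^sup>+p. f (p, \<epsilon>\<^sup>2 * p - \<epsilon> * y) * ennreal (?\<phi> (- \<epsilon> * y + c * p) * ?\<phi> y) \<partial>lborel)"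
      by (subst nn_integral_real_affine[where c=c and t="- \<epsilon> * y"]) (simp_all only: 1 2, auto)
  qed
  also have "\<dots> = (\<integral>\<^sup>+y. \<integral>\<^sup>+p. c * (f (p, \<epsilon>\<^sup>2 * p - \<epsilon> * y) * ennreal (?\<phi> (- \<epsilon> * y + c * p) * ?\<phi> y)) \<partial>lborel \<partial>lborel)"
    by (subst nn_integral_cmult) auto
  also have "\<dots> = (\<integral>\<^sup>+p. \<integral>\<^sup>+y. c * (f (p, \<epsilon>\<^sup>2 * p - \<epsilon> * y) * ennreal (?\<phi> (- \<epsilon> * y + c * p) * ?\<phi> y)) \<partial>lborel \<partial>lborel)"
    by (rule lborel_pair.Fubini') simp
  also have "\<dots> = (\<integral>\<^sup>+p. ennreal (1 / \<epsilon>) * (\<integral>\<^sup>+r. c * (f (p, r) * ennreal (?\<phi> (p + r) * ?\<phi> (\<epsilon> * p - r / \<epsilon>))) \<partial>lborel) \<partial>lborel)"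
  proof (rule nn_integral_cong)
    fix p
    have 3: "\<epsilon>\<^sup>2 * p - \<epsilon> * (\<epsilon> * p + (- 1 / \<epsilon>) * r) = r" for r
      by (simp add: field_simps power2_eq_square)
    have 4: "- \<epsilon> * (\<epsilon> * p + (- 1 / \<epsilon>) * r) + c * p = p + r" for r
      unfolding c_def by (simp add: field_simps power2_eq_square)
    show "(\<integral>\<^sup>+y. c * (f (p, \<epsilon>\<^sup>2 * p - \<epsilon> * y) * ennreal (?\<phi> (- \<epsilon> * y + c * p) * ?\<phi> y)) \<partial>lborel) =
      ennreal (1 / \<epsilon>) * (\<integral>\<^sup>+r. c * (f (p, r) * ennreal (?\<phi> (p + r) * ?\<phi> (\<epsilon> * p - r / \<epsilon>))) \<partial>lborel)"
      by (subst nn_integral_real_affine[where c="- 1 / \<epsilon>" and t="\<epsilon> * p"]) (simp_all only: 3 4, auto)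
  qed
  also have "\<dots> = (\<integral>\<^sup>+p. \<integral>\<^sup>+r. ennreal (1 / \<epsilon>) * (c * (f (p, r) * ennreal (?\<phi> (p + r) * ?\<phi> (\<epsilon> * p - r / \<epsilon>)))) \<partial>lborel \<partial>lborel)"
    by (subst nn_integral_cmult) auto
  also have "\<dots> = ?R"
  proof (intro nn_integral_cong)
    fix p r
    have "ennreal (1 / \<epsilon>) * (c * (f (p, r) * ennreal (?\<phi> (p + r) * ?\<phi> (\<epsilon> * p - r / \<epsilon>)))) =
        f (p, r) * (ennreal (1 / \<epsilon>) * (ennreal c * ennreal (?\<phi> (p + r) * ?\<phi> (\<epsilon> * p - r / \<epsilon>))))"
      by (simp add: mult_ac)
    also have "ennreal (1 / \<epsilon>) * (ennreal c * ennreal (?\<phi> (p + r) * ?\<phi> (\<epsilon> * p - r / \<epsilon>))) =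
        ennreal (c / \<epsilon> * (?\<phi> (p + r) * ?\<phi> (\<epsilon> * p - r / \<epsilon>)))"
      by (simp add: ennreal_mult[symmetric])
    also note normal_density_rotation[OF \<open>0 < \<epsilon>\<close> \<sigma>, of p r, folded c_def]
    finally show "ennreal (1 / \<epsilon>) * (c * (f (p, r) * ennreal (?\<phi> (p + r) * ?\<phi> (\<epsilon> * p - r / \<epsilon>)))) =
      f (p, r) * ennreal (normal_density 0 (\<sigma> / sqrt (1 + \<epsilon>\<^sup>2)) p * normal_density 0 (\<epsilon> * \<sigma> / sqrt (1 + \<epsilon>\<^sup>2)) r)"
      by (simp add: c_def)
  qed
  finally show ?thesis .
qed

context prob_space
begin

text \<open>\<open>U\<close> and \<open>V = X - U\<close> have covariance \<open>0\<close>, and for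
  jointly normal variables this means independence. The marginal laws come from sums of independent
  normals; independence then amounts to the joint law being the product of these two known
  densities.\<close>

lemma
  fixes X Y :: "'a \<Rightarrow> real" and \<epsilon> \<sigma> :: real
  assumes \<epsilon>: "0 < \<epsilon>" and \<sigma>: "0 < \<sigma>" and XY: "indep_var borel X borel Y"
    and X: "distributed M lborel X (normal_density 0 \<sigma>)"
    and Y: "distributed M lborel Y (normal_density 0 \<sigma>)"
  defines "U \<equiv> \<lambda>\<omega>. (X \<omega> + \<epsilon> * Y \<omega>) / (1 + \<epsilon>\<^sup>2)"
    and "V \<equiv> \<lambda>\<omega>. (\<epsilon>\<^sup>2 * X \<omega> - \<epsilon> * Y \<omega>) / (1 + \<epsilon>\<^sup>2)"
  shows normal_rotation_fst: "distributed M lborel U (normal_density 0 (\<sigma> / sqrt (1 + \<epsilon>\<^sup>2)))"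
    and normal_rotation_snd: "distributed M lborel V (normal_density 0 (\<epsilon> * \<sigma> / sqrt (1 + \<epsilon>\<^sup>2)))"
    and normal_rotation_indep: "indep_var borel U borel V"
proof -
  have [measurable]: "X \<in> borel_measurable M" "Y \<in> borel_measurable M"
    using X Y by (auto dest: distributed_measurable)
  let ?c = "1 + \<epsilon>\<^sup>2"
  have c: "0 < ?c"
    by (simp add: add_pos_nonneg)
  have sc: "sqrt (\<sigma>\<^sup>2 + (\<epsilon> * \<sigma>)\<^sup>2) = \<sigma> * sqrt ?c"
  proof -
    have "\<sigma>\<^sup>2 + (\<epsilon> * \<sigma>)\<^sup>2 = \<sigma>\<^sup>2 * ?c"
      by (simp add: algebra_simps power2_eq_square)
    then show ?thesis
      using \<sigma> by (simp add: real_sqrt_mult)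
  qed
  have sc2: "sqrt ((\<epsilon>\<^sup>2 * \<sigma>)\<^sup>2 + (\<epsilon> * \<sigma>)\<^sup>2) = \<epsilon> * \<sigma> * sqrt ?c"
  proof -
    have "(\<epsilon>\<^sup>2 * \<sigma>)\<^sup>2 + (\<epsilon> * \<sigma>)\<^sup>2 = (\<epsilon> * \<sigma>)\<^sup>2 * ?c"
      by (simp add: algebra_simps power2_eq_square)
    then show ?thesis
      using \<sigma> \<epsilon> by (simp add: real_sqrt_mult)
  qed
  have rt: "a * sqrt ?c / ?c = a / sqrt ?c" for a
    using c by (simp add: field_simps)
  have eY: "distributed M lborel (\<lambda>\<omega>. \<epsilon> * Y \<omega>) (normal_density 0 (\<epsilon> * \<sigma>))"
    using normal_density_affine[OF Y \<sigma>, of \<epsilon> 0] \<epsilon> by simp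
  have eX: "distributed M lborel (\<lambda>\<omega>. \<epsilon>\<^sup>2 * X \<omega>) (normal_density 0 (\<epsilon>\<^sup>2 * \<sigma>))"
    using normal_density_affine[OF X \<sigma>, of "\<epsilon>\<^sup>2" 0] \<epsilon> by simp
  have "distributed M lborel (\<lambda>\<omega>. X \<omega> + \<epsilon> * Y \<omega>) (normal_density 0 (\<sigma> * sqrt ?c))"
    using add_indep_normal[OF indep_var_compose[OF XY, of id borel "\<lambda>y. \<epsilon> * y" borel, unfolded comp_def], of \<sigma> "\<epsilon> * \<sigma>" 0 0]
      X eY \<epsilon> \<sigma> sc by simp
  from normal_density_affine[OF this, of "1 / ?c" 0]
  show U: "distributed M lborel U (normal_density 0 (\<sigma> / sqrt ?c))"
    using c \<sigma> rt[of \<sigma>] by (simp add: U_def)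
  have "distributed M lborel (\<lambda>\<omega>. \<epsilon>\<^sup>2 * X \<omega> - \<epsilon> * Y \<omega>) (normal_density 0 (\<epsilon> * \<sigma> * sqrt ?c))"
    using diff_indep_normal[OF indep_var_compose[OF XY, of "\<lambda>x. \<epsilon>\<^sup>2 * x" borel "\<lambda>y. \<epsilon> * y" borel, unfolded comp_def], of "\<epsilon>\<^sup>2 * \<sigma>" "\<epsilon> * \<sigma>" 0 0]
      eX eY \<epsilon> \<sigma> sc2 by simp
  from normal_density_affine[OF this, of "1 / ?c" 0]
  show V: "distributed M lborel V (normal_density 0 (\<epsilon> * \<sigma> / sqrt ?c))"
    using c \<epsilon> \<sigma> rt[of "\<epsilon> * \<sigma>"] by (simp add: V_def)
  let ?f = "normal_density 0 \<sigma>"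
  let ?pU = "normal_density 0 (\<sigma> / sqrt ?c)" and ?pV = "normal_density 0 (\<epsilon> * \<sigma> / sqrt ?c)"
  interpret pU: prob_space "density lborel ?pU"
    using \<sigma> c by (intro prob_space_normal_density) simp
  interpret pV: prob_space "density lborel ?pV"
    using \<epsilon> \<sigma> c by (intro prob_space_normal_density) simp
  have joint: "distributed M (lborel \<Otimes>\<^sub>M lborel) (\<lambda>\<omega>. (X \<omega>, Y \<omega>)) (\<lambda>(x, y). ennreal (?f x) * ennreal (?f y))"
    using XY by (intro distributed_joint_indep X Y sigma_finite_lborel) (simp add: indep_var_distribution_eq cong: distr_cong)
  have "indep_var lborel U lborel V"
    unfolding indep_var_distribution_eq
  proof safe
    show [measurable]: "random_variable lborel U" "random_variable lborel V"
      by (auto simp: U_def V_def)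
    have "distr M lborel U \<Otimes>\<^sub>M distr M lborel V = density lborel ?pU \<Otimes>\<^sub>M density lborel ?pV"
      using U V by (simp add: distributed_def)
    also have "\<dots> = density (lborel \<Otimes>\<^sub>M lborel) (\<lambda>(x, y). ennreal (?pU x) * ennreal (?pV y))"
      by (intro pair_measure_density) (auto intro: sigma_finite_lborel pV.sigma_finite_measure_axioms)
    also have "\<dots> = distr M (lborel \<Otimes>\<^sub>M lborel) (\<lambda>\<omega>. (U \<omega>, V \<omega>))"
    proof (rule measure_eqI)
      fix A assume "A \<in> sets (density (lborel \<Otimes>\<^sub>M lborel) (\<lambda>(x, y). ennreal (?pU x) * ennreal (?pV y)))"
      then have [measurable]: "A \<in> sets (borel \<Otimes>\<^sub>M borel)"
        by (simp cong: sets_pair_measure_cong)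
      let ?g = "\<lambda>z::real \<times> real. indicator A ((fst z + \<epsilon> * snd z) / ?c, (\<epsilon>\<^sup>2 * fst z - \<epsilon> * snd z) / ?c) :: ennreal"
      have "emeasure (distr M (lborel \<Otimes>\<^sub>M lborel) (\<lambda>\<omega>. (U \<omega>, V \<omega>))) A = (\<integral>\<^sup>+\<omega>. ?g (X \<omega>, Y \<omega>) \<partial>M)"
        by (subst nn_integral_indicator[symmetric], simp cong: sets_pair_measure_cong, subst nn_integral_distr)
          (auto simp: U_def V_def cong: sets_pair_measure_cong)
      also have "\<dots> = (\<integral>\<^sup>+z. (case z of (x, y) \<Rightarrow> ennreal (?f x) * ennreal (?f y)) * ?g z \<partial>(lborel \<Otimes>\<^sub>M lborel))"
        by (rule distributed_nn_integral[OF joint, symmetric]) simp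
      also have "\<dots> = (\<integral>\<^sup>+y. \<integral>\<^sup>+x. ennreal (?f x) * ennreal (?f y) * ?g (x, y) \<partial>lborel \<partial>lborel)"
        by (subst lborel_pair.nn_integral_snd[symmetric]) auto
      also have "\<dots> = (\<integral>\<^sup>+y. \<integral>\<^sup>+x. indicator A ((x + \<epsilon> * y) / ?c, (\<epsilon>\<^sup>2 * x - \<epsilon> * y) / ?c) * ennreal (?f x * ?f y) \<partial>lborel \<partial>lborel)"
        by (simp add: ennreal_mult' mult.commute)
      also have "\<dots> = (\<integral>\<^sup>+p. \<integral>\<^sup>+r. indicator A (p, r) * ennreal (?pU p * ?pV r) \<partial>lborel \<partial>lborel)"
        by (rule nn_integral_normal_rotation[OF \<epsilon> \<sigma>]) simp
      also have "\<dots> = (\<integral>\<^sup>+z. (case z of (x, y) \<Rightarrow> ennreal (?pU x) * ennreal (?pV y)) * indicator A z \<partial>(lborel \<Otimes>\<^sub>M lborel))"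
        by (subst lborel.nn_integral_fst[symmetric]) (auto simp: ennreal_mult' mult.commute)
      also have "\<dots> = emeasure (density (lborel \<Otimes>\<^sub>M lborel) (\<lambda>(x, y). ennreal (?pU x) * ennreal (?pV y))) A"
        by (subst emeasure_density) (auto cong: sets_pair_measure_cong)
      finally show "emeasure (density (lborel \<Otimes>\<^sub>M lborel) (\<lambda>(x, y). ennreal (?pU x) * ennreal (?pV y))) A =
        emeasure (distr M (lborel \<Otimes>\<^sub>M lborel) (\<lambda>\<omega>. (U \<omega>, V \<omega>))) A" ..
    qed simp
    finally show "distr M lborel U \<Otimes>\<^sub>M distr M lborel V = distr M (lborel \<Otimes>\<^sub>M lborel) (\<lambda>\<omega>. (U \<omega>, V \<omega>))" .
  qed
  then show "indep_var borel U borel V"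
    using indep_var_compose[of lborel U lborel V id borel id borel] by simp
qed

end

section \<open>Rotated increments of two independent Wiener processes\<close>

definition increment :: "real \<Rightarrow> (real \<Rightarrow> 'a \<Rightarrow> real) \<Rightarrow> nat \<Rightarrow> 'a \<Rightarrow> real" where
  "increment \<delta> W i \<omega> = W (real (Suc i) * \<delta>) \<omega> - W (real i * \<delta>) \<omega>"

context standard_wiener_process
begin

lemma indep_vars_increment:
  assumes "0 < \<delta>"
  shows "indep_vars (\<lambda>_. borel) (increment \<delta> W) {..<K}"
  unfolding increment_def[abs_def]
  by (rule indep_increments[where t="\<lambda>i. real i * \<delta>"]) (use assms in auto)

lemma distributed_increment:
  assumes "0 < \<delta>"
  shows "distributed M lborel (increment \<delta> W i) (normal_density 0 (sqrt \<delta>))"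
  using normal_increments[of "real i * \<delta>" "real (Suc i) * \<delta>"] assms
  by (simp add: increment_def[abs_def] distrib_right left_diff_distrib[symmetric])

end

text \<open>Finitely many grid increments are a measurable function of the path, so independence in
  path space passes to the vectors of increments.\<close>

lemma indep_var_increments:
  assumes "prob_space M" "indep_processes M V W" "0 < \<delta>"
  shows "prob_space.indep_var M (PiM {..<K} (\<lambda>_. borel)) (\<lambda>\<omega>. \<lambda>i\<in>{..<K}. increment \<delta> V i \<omega>)
    (PiM {..<K} (\<lambda>_. borel)) (\<lambda>\<omega>. \<lambda>i\<in>{..<K}. increment \<delta> W i \<omega>)"
proof -
  interpret prob_space M by fact
  let ?f = "\<lambda>x::real \<Rightarrow> real. \<lambda>i\<in>{..<K}. x (real (Suc i) * \<delta>) - x (real i * \<delta>)"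
  have f: "?f \<in> (PiM {0..} (\<lambda>_. borel)) \<rightarrow>\<^sub>M (PiM {..<K} (\<lambda>_. borel))"
    using \<open>0 < \<delta>\<close> by (intro measurable_restrict borel_measurable_diff measurable_component_singleton) auto
  have eq: "?f (\<lambda>t\<in>{0..}. Z t \<omega>) = (\<lambda>i\<in>{..<K}. increment \<delta> Z i \<omega>)" for Z :: "real \<Rightarrow> 'a \<Rightarrow> real" and \<omega>
    using \<open>0 < \<delta>\<close> by (auto simp: increment_def fun_eq_iff)
  show ?thesis
    using indep_var_compose[OF assms(2)[unfolded indep_processes_def] f f] unfolding comp_def eq .
qed

lemma
  fixes B N :: "real \<Rightarrow> 'a \<Rightarrow> real" and \<epsilon> \<delta> :: real
  assumes B: "standard_wiener_process M B" and N: "standard_wiener_process M N"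
    and BN: "indep_processes M B N" and \<epsilon>: "0 < \<epsilon>" and \<delta>: "0 < \<delta>"
  defines "U \<equiv> \<lambda>i \<omega>. (increment \<delta> B i \<omega> + \<epsilon> * increment \<delta> N i \<omega>) / (1 + \<epsilon>\<^sup>2)"
    and "V \<equiv> \<lambda>i \<omega>. (\<epsilon>\<^sup>2 * increment \<delta> B i \<omega> - \<epsilon> * increment \<delta> N i \<omega>) / (1 + \<epsilon>\<^sup>2)"
  shows distributed_estimate_increment:
      "distributed M lborel (U i) (normal_density 0 (sqrt \<delta> / sqrt (1 + \<epsilon>\<^sup>2)))"
    and distributed_error_increment:
      "distributed M lborel (V i) (normal_density 0 (\<epsilon> * sqrt \<delta> / sqrt (1 + \<epsilon>\<^sup>2)))"
    and indep_estimate_error_increments: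
      "prob_space.indep_vars M (\<lambda>_. borel) (\<lambda>(b, i). if b then U i else V i) (UNIV \<times> {..<K})"
proof -
  interpret B: standard_wiener_process M B by fact
  interpret N: standard_wiener_process M N by fact
  have pair: "B.indep_var borel (increment \<delta> B i) borel (increment \<delta> N i)" for i
    using B.indep_var_compose[OF indep_var_increments[OF B.prob_space_axioms BN \<delta>, of "Suc i"],
      of "\<lambda>x. x i" borel "\<lambda>x. x i" borel]
    by (simp add: comp_def)
  note rotation = \<epsilon> _ pair B.distributed_increment[OF \<delta>] N.distributed_increment[OF \<delta>]
  show "distributed M lborel (U i) (normal_density 0 (sqrt \<delta> / sqrt (1 + \<epsilon>\<^sup>2)))" for i
    unfolding U_def using B.normal_rotation_fst[OF rotation] \<delta> by simp
  show "distributed M lborel (V i) (normal_density 0 (\<epsilon> * sqrt \<delta> / sqrt (1 + \<epsilon>\<^sup>2)))" for i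
    unfolding V_def using B.normal_rotation_snd[OF rotation] \<delta> by simp
  have UV: "B.indep_var borel (U i) borel (V i)" for i
    unfolding U_def V_def using B.normal_rotation_indep[OF rotation] \<delta> by simp
  show "B.indep_vars (\<lambda>_. borel) (\<lambda>(b, i). if b then U i else V i) (UNIV \<times> {..<K})"
  \<comment> \<open>The criteria for finite families ask for a nonempty index set.\<close>
  proof (cases "K = 0")
    case True
    then show ?thesis
      by (simp add: B.indep_vars_def B.indep_sets_def)
  next
    case False
    then have K: "{..<K} \<noteq> {}"
      by auto
    let ?Z = "\<lambda>(b, i). if b then increment \<delta> B i else increment \<delta> N i"
    have "B.indep_vars (\<lambda>_. borel) ?Z (UNIV \<times> {..<K})"
      by (intro B.indep_vars_bool_Times_if_indep_families finite_lessThan K B.indep_vars_increment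
        N.indep_vars_increment indep_var_increments B.prob_space_axioms BN \<delta>)
    \<comment> \<open>Regrouping by time step: the blocks \<open>UNIV \<times> {i}\<close> are
      disjoint, so the pairs of increments are independent across \<open>i\<close> and each pair can
      be rotated on its own.\<close>
    then have "B.indep_vars (\<lambda>i. PiM (UNIV \<times> {i}) (\<lambda>_. borel)) (\<lambda>i \<omega>. \<lambda>j\<in>UNIV \<times> {i}. ?Z j \<omega>) {..<K}"
      by (rule B.indep_vars_restrict) (auto simp: disjoint_family_on_def)
    from B.indep_vars_compose2[OF this, of
        "\<lambda>i x. ((x (True, i) + \<epsilon> * x (False, i)) / (1 + \<epsilon>\<^sup>2), (\<epsilon>\<^sup>2 * x (True, i) - \<epsilon> * x (False, i)) / (1 + \<epsilon>\<^sup>2))"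
        "\<lambda>_. borel \<Otimes>\<^sub>M borel"]
    have "B.indep_vars (\<lambda>_. borel \<Otimes>\<^sub>M borel) (\<lambda>i \<omega>. (U i \<omega>, V i \<omega>)) {..<K}"
      by (simp add: U_def V_def)
    then show ?thesis
      by (intro B.indep_vars_bool_Times_if_indep_pairs finite_lessThan K UV)
  qed
qed

section \<open>Passage times of Gaussian walks\<close>

text \<open>The disjunct \<open>k = K\<close> guarantees that a least element exists and bounds the
  passage time. The value \<open>K\<close> leaves open whether the level has been reached
  there.\<close>

definition capped_passage :: "real \<Rightarrow> nat \<Rightarrow> (nat \<Rightarrow> real) \<Rightarrow> nat" where
  "capped_passage l K x = (LEAST k. k = K \<or> l \<le> x k)"

lemma capped_passage_le: "capped_passage l K x \<le> K"
  by (auto simp: capped_passage_def intro: Least_le)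

lemma capped_passage_le_if_reached: "l \<le> x k \<Longrightarrow> capped_passage l K x \<le> k"
  by (auto simp: capped_passage_def intro: Least_le)

lemma reached_at_capped_passage: "capped_passage l K x = K \<or> l \<le> x (capped_passage l K x)"
  unfolding capped_passage_def by (rule LeastI[of _ K]) simp

lemma below_level_before_capped_passage: "j < capped_passage l K x \<Longrightarrow> x j < l"
  unfolding capped_passage_def by (auto dest: not_less_Least)

text \<open>Makes the passage a stopping time: \<open>k < capped_passage l K x\<close> depends only
  on the positions up to \<open>k\<close>, hence for a walk only on the increments with index below
  \<open>k\<close>.\<close>

lemma less_capped_passage_iff:
  assumes "k < K"
  shows "k < capped_passage l K x \<longleftrightarrow> (\<forall>j\<le>k. x j < l)"
  using reached_at_capped_passage[of l K x] below_level_before_capped_passage[of _ l K x] assms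
  by (metis le_less_trans linorder_not_le)

lemma capped_passage_eq_iff:
  assumes "k \<le> K"
  shows "capped_passage l K x = k \<longleftrightarrow> (k = K \<or> l \<le> x k) \<and> (\<forall>j<k. x j < l)"
  using reached_at_capped_passage[of l K x] below_level_before_capped_passage[of _ l K x]
    capped_passage_le_if_reached[of l x k K] capped_passage_le[of l K x] assms
  by (metis linorder_neqE_nat linorder_not_le)

lemma capped_passage_overshoot:
  assumes "x 0 \<le> l" "0 \<le> d" "\<And>i. i < K \<Longrightarrow> x (Suc i) \<le> x i + d"
  shows "x (capped_passage l K x) \<le> l + d"
proof (cases "capped_passage l K x")
  case 0
  then show ?thesis
    using assms by simp
next
  case (Suc i)
  then have "i < K" "x i < l"
    using capped_passage_le[of l K x] below_level_before_capped_passage[of i l K x] by auto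
  then show ?thesis
    using assms(3)[of i] Suc by simp
qed

text \<open>A jump above \<open>\<theta>\<close> satisfies
  \<open>\<bar>x i\<bar> * \<theta> ^ 3 \<le> x i ^ 4\<close>. All jumps are thus controlled at once
  by a quantity with computable mean. On a grid of mesh \<open>\<delta>\<close>, squares would give
  \<open>K * \<delta> / \<theta>\<close>, the horizon over \<open>\<theta>\<close>, which does not
  vanish; fourth powers give \<open>K * \<delta>\<^sup>2 / \<theta> ^ 3\<close>, which can be made
  small.\<close>

lemma abs_le_fourth_powers:
  fixes x :: "nat \<Rightarrow> real"
  assumes "0 < \<theta>" "i < K"
  shows "\<bar>x i\<bar> \<le> \<theta> + (\<Sum>j<K. x j ^ 4) / \<theta> ^ 3"
proof (cases "\<bar>x i\<bar> \<le> \<theta>")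
  case True
  then show ?thesis
    using assms by (auto intro!: add_increasing2 divide_nonneg_nonneg sum_nonneg)
next
  case False
  then have "\<bar>x i\<bar> * \<theta> ^ 3 \<le> \<bar>x i\<bar> * \<bar>x i\<bar> ^ 3"
    using assms by (intro mult_left_mono power_mono) auto
  also have "\<dots> = x i ^ 4"
    by (simp add: power_Suc[symmetric] power_even_abs del: power_Suc)
  also have "\<dots> \<le> (\<Sum>j<K. x j ^ 4)"
    using assms by (intro member_le_sum) auto
  finally show ?thesis
    using assms by (simp add: field_simps add_increasing)
qed

lemma fourth_power_add_le:
  fixes x y :: real
  shows "(x + y) ^ 4 \<le> 8 * (x ^ 4 + y ^ 4)"
proof -
  have "(x + y)\<^sup>2 \<le> 2 * (x\<^sup>2 + y\<^sup>2)"
    using sum_squares_bound[of x y] by (simp add: power2_sum)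
  then have "((x + y)\<^sup>2)\<^sup>2 \<le> (2 * (x\<^sup>2 + y\<^sup>2))\<^sup>2"
    by (intro power_mono) auto
  also have "\<dots> = 4 * (x\<^sup>2 + y\<^sup>2)\<^sup>2"
    by (simp only: power_mult_distrib) simp
  also have "\<dots> \<le> 4 * (2 * ((x\<^sup>2)\<^sup>2 + (y\<^sup>2)\<^sup>2))"
    using sum_squares_bound[of "x\<^sup>2" "y\<^sup>2"] by (simp add: power2_sum)
  finally show ?thesis
    by simp
qed

text \<open>Applied with \<open>m\<close> of the order of the horizon and a fourth moment of the
  order of its square, so that the quotient tends to \<open>0\<close>. The analogous bound with
  squares would only stay bounded.\<close>

lemma positive_part_le_fourth_power:
  fixes g m :: real
  assumes "0 < m"
  shows "max 0 (g - m) \<le> g ^ 4 / m ^ 3"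
proof (cases "g \<le> m")
  case True
  then show ?thesis
    using assms by (simp add: max_def)
next
  case False
  have "(g - m) * m ^ 3 \<le> g * g ^ 3"
    using False assms by (intro mult_mono power_mono) auto
  also have "\<dots> = g ^ 4"
    by (simp add: power_Suc[symmetric] del: power_Suc)
  finally show ?thesis
    using False assms by (simp add: field_simps)
qed

section \<open>Normal moments and products over disjoint blocks\<close>

context prob_space
begin

lemma
  assumes X: "distributed M lborel X (normal_density 0 \<sigma>)" and \<sigma>: "0 < \<sigma>"
  shows integrable_normal: "integrable M X"
    and integrable_normal_pow4: "integrable M (\<lambda>\<omega>. X \<omega> ^ 4)"
    and expectation_normal_pow4: "expectation (\<lambda>\<omega>. X \<omega> ^ 4) = 3 * \<sigma> ^ 4"
    and integrable_normal_negpart: "integrable M (\<lambda>\<omega>. max 0 (- X \<omega>))"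
    and expectation_normal_negpart: "expectation (\<lambda>\<omega>. max 0 (- X \<omega>)) = \<sigma> / sqrt (2 * pi)"
proof -
  have int: "integrable M (\<lambda>\<omega>. X \<omega> ^ k)" for k
    using integrable_normal_moment[OF \<sigma>, of 0 k] distributed_integrable[OF X, of "\<lambda>x. x ^ k"] by simp
  from int[of 1] show X_int: "integrable M X"
    by simp
  from int show "integrable M (\<lambda>\<omega>. X \<omega> ^ 4)" .
  \<comment> \<open>The general formula for even moments has the denominator
    \<open>(2 / \<sigma>\<^sup>2) ^ k * fact k\<close>; for \<open>k = 2\<close> it yields
    \<open>fact 4 / (4 / \<sigma> ^ 4 * 2) = 3 * \<sigma> ^ 4\<close>.\<close>
  have "(2 / \<sigma>\<^sup>2)\<^sup>2 = 4 / \<sigma> ^ 4"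
    by (simp add: power_divide)
  then have "(\<integral>x. normal_density 0 \<sigma> x * x ^ 4 \<partial>lborel) = 3 * \<sigma> ^ 4"
    using integral_normal_moment_even[OF \<sigma>, of 0 2] by (simp add: fact_numeral)
  then show "expectation (\<lambda>\<omega>. X \<omega> ^ 4) = 3 * \<sigma> ^ 4"
    using distributed_integral[OF X, of "\<lambda>x. x ^ 4"] by simp
  have E0: "expectation X = 0"
    by (rule normal_distributed_expectation[OF \<sigma> X])
  have Eabs: "expectation (\<lambda>\<omega>. \<bar>X \<omega>\<bar>) = \<sigma> * sqrt (2 / pi)"
    using integral_normal_moment_abs_odd[OF \<sigma>, of 0 0] distributed_integral[OF X, of "\<lambda>x. \<bar>x\<bar>"]
    by simp
  have eq: "max 0 (- X \<omega>) = (\<bar>X \<omega>\<bar> - X \<omega>) / 2" for \<omega>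
    by (simp add: max_def)
  show "integrable M (\<lambda>\<omega>. max 0 (- X \<omega>))"
    unfolding eq using X_int by simp
  have "sqrt (2 / pi) / 2 = 1 / sqrt (2 * pi)"
    by (simp add: real_sqrt_divide real_sqrt_mult field_simps)
  then show "expectation (\<lambda>\<omega>. max 0 (- X \<omega>)) = \<sigma> / sqrt (2 * pi)"
    unfolding eq using X_int E0 Eabs by (simp add: field_simps)
qed

lemma
  fixes f g :: "('i \<Rightarrow> 'b) \<Rightarrow> real"
  assumes Z: "indep_vars N Z I" "A \<inter> B = {}" "A \<subseteq> I" "B \<subseteq> I"
    and f: "f \<in> borel_measurable (PiM A N)" and g: "g \<in> borel_measurable (PiM B N)"
    and int: "integrable M (\<lambda>\<omega>. f (\<lambda>i\<in>A. Z i \<omega>))" "integrable M (\<lambda>\<omega>. g (\<lambda>i\<in>B. Z i \<omega>))"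
  shows integrable_mult_indep_blocks: "integrable M (\<lambda>\<omega>. f (\<lambda>i\<in>A. Z i \<omega>) * g (\<lambda>i\<in>B. Z i \<omega>))"
    and expectation_mult_indep_blocks: "expectation (\<lambda>\<omega>. f (\<lambda>i\<in>A. Z i \<omega>) * g (\<lambda>i\<in>B. Z i \<omega>)) =
      expectation (\<lambda>\<omega>. f (\<lambda>i\<in>A. Z i \<omega>)) * expectation (\<lambda>\<omega>. g (\<lambda>i\<in>B. Z i \<omega>))"
proof -
  have "indep_var borel (\<lambda>\<omega>. f (\<lambda>i\<in>A. Z i \<omega>)) borel (\<lambda>\<omega>. g (\<lambda>i\<in>B. Z i \<omega>))"
    using indep_var_compose[OF indep_var_restrict[OF Z] f g] by (simp add: comp_def)
  then show "integrable M (\<lambda>\<omega>. f (\<lambda>i\<in>A. Z i \<omega>) * g (\<lambda>i\<in>B. Z i \<omega>))"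
    "expectation (\<lambda>\<omega>. f (\<lambda>i\<in>A. Z i \<omega>) * g (\<lambda>i\<in>B. Z i \<omega>)) =
      expectation (\<lambda>\<omega>. f (\<lambda>i\<in>A. Z i \<omega>)) * expectation (\<lambda>\<omega>. g (\<lambda>i\<in>B. Z i \<omega>))"
    using int by (rule indep_var_integrable, rule indep_var_lebesgue_integral)
qed

end

section \<open>Two Gaussian walks with common drift, stopped at bounded times\<close>

locale gaussian_walks = prob_space M
  for M :: "'a measure" +
  fixes U V :: "nat \<Rightarrow> 'a \<Rightarrow> real" and K :: nat and a \<sigma> \<rho> l :: real
  assumes a_pos: "0 < a" and \<sigma>_pos: "0 < \<sigma>" and \<rho>_pos: "0 < \<rho>" and l_pos: "0 < l"
    and normal_U: "\<And>i. distributed M lborel (U i) (normal_density 0 \<sigma>)"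
    and normal_V: "\<And>i. distributed M lborel (V i) (normal_density 0 \<rho>)"
    and indep: "indep_vars (\<lambda>_. borel) (\<lambda>(b, i). if b then U i else V i) (UNIV \<times> {..<K})"
begin

definition Z :: "bool \<times> nat \<Rightarrow> 'a \<Rightarrow> real" where
  "Z = (\<lambda>(b, i). if b then U i else V i)"

definition estimate :: "nat \<Rightarrow> 'a \<Rightarrow> real" where
  "estimate k \<omega> = (\<Sum>i<k. a + U i \<omega>)"

definition signal :: "nat \<Rightarrow> 'a \<Rightarrow> real" where
  "signal k \<omega> = (\<Sum>i<k. a + U i \<omega> + V i \<omega>)"

definition T :: "'a \<Rightarrow> nat" where
  "T \<omega> = capped_passage l K (\<lambda>k. estimate k \<omega>)"

definition S :: "'a \<Rightarrow> nat" where
  "S \<omega> = capped_passage l K (\<lambda>k. signal k \<omega>)"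

text \<open>Stopping times bounded by \<open>K\<close> for the filtration generated by both kinds of
  increments. Dependence on the past alone is expressed by a predicate on the vector of earlier
  increments, the form in which independence of disjoint blocks applies.\<close>

definition predictable :: "('a \<Rightarrow> nat) \<Rightarrow> bool" where
  "predictable \<tau> \<longleftrightarrow> \<tau> \<in> M \<rightarrow>\<^sub>M count_space UNIV \<and> (\<forall>\<omega>. \<tau> \<omega> \<le> K) \<and>
    (\<forall>k<K. \<exists>P. Measurable.pred (PiM (UNIV \<times> {..<k}) (\<lambda>_. borel)) P \<and>
      (\<forall>\<omega>. k < \<tau> \<omega> \<longleftrightarrow> P (\<lambda>j\<in>UNIV \<times> {..<k}. Z j \<omega>)))"

lemma measurable_U[measurable]: "U i \<in> borel_measurable M"
  and measurable_V[measurable]: "V i \<in> borel_measurable M"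
  using normal_U[of i] normal_V[of i] by (simp_all add: distributed_def)

lemma indep_Z: "indep_vars (\<lambda>_. borel) Z (UNIV \<times> {..<K})"
  using indep by (simp add: Z_def)

lemma measurable_estimate[measurable]: "estimate k \<in> borel_measurable M"
  and measurable_signal[measurable]: "signal k \<in> borel_measurable M"
  by (simp_all add: estimate_def[abs_def] signal_def[abs_def])

lemma measurable_T[measurable]: "T \<in> M \<rightarrow>\<^sub>M count_space UNIV"
  and measurable_S[measurable]: "S \<in> M \<rightarrow>\<^sub>M count_space UNIV"
  unfolding T_def[abs_def] S_def[abs_def] capped_passage_def by measurable

lemma predictable_max:
  assumes "predictable \<tau>" "predictable \<tau>'"
  shows "predictable (\<lambda>\<omega>. max (\<tau> \<omega>) (\<tau>' \<omega>))"
proof -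
  have "\<exists>P. Measurable.pred (PiM (UNIV \<times> {..<k}) (\<lambda>_. borel)) P \<and>
      (\<forall>\<omega>. k < max (\<tau> \<omega>) (\<tau>' \<omega>) \<longleftrightarrow> P (\<lambda>j\<in>UNIV \<times> {..<k}. Z j \<omega>))" if k: "k < K" for k
  proof -
    from assms k obtain P P' where [measurable]:
        "Measurable.pred (PiM (UNIV \<times> {..<k}) (\<lambda>_. borel)) P" "Measurable.pred (PiM (UNIV \<times> {..<k}) (\<lambda>_. borel)) P'"
      and "\<forall>\<omega>. k < \<tau> \<omega> \<longleftrightarrow> P (\<lambda>j\<in>UNIV \<times> {..<k}. Z j \<omega>)" "\<forall>\<omega>. k < \<tau>' \<omega> \<longleftrightarrow> P' (\<lambda>j\<in>UNIV \<times> {..<k}. Z j \<omega>)"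
      unfolding predictable_def by blast
    then show ?thesis
      by (intro exI[of _ "\<lambda>x. P x \<or> P' x"]) (auto simp: less_max_iff_disj)
  qed
  moreover have \<tau>: "\<tau> \<in> M \<rightarrow>\<^sub>M count_space UNIV" and \<tau>': "\<tau>' \<in> M \<rightarrow>\<^sub>M count_space UNIV"
    using assms by (auto simp: predictable_def)
  have "(\<lambda>\<omega>. max (\<tau> \<omega>) (\<tau>' \<omega>)) \<in> M \<rightarrow>\<^sub>M count_space UNIV"
    by (rule measurable_compose_countable[OF _ \<tau>]) (rule measurable_compose[OF \<tau>'], simp)
  ultimately show ?thesis
    using assms by (auto simp: predictable_def)
qed

lemma predictable_T: "predictable T"
proof -
  have "\<exists>P. Measurable.pred (PiM (UNIV \<times> {..<k}) (\<lambda>_. borel)) P \<and>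
      (\<forall>\<omega>. k < T \<omega> \<longleftrightarrow> P (\<lambda>j\<in>UNIV \<times> {..<k}. Z j \<omega>))" if k: "k < K" for k
  proof (intro exI conjI allI)
    show "Measurable.pred (PiM (UNIV \<times> {..<k}) (\<lambda>_. borel)) (\<lambda>x. \<forall>j\<in>{..k}. (\<Sum>i<j. a + x (True, i)) < l)"
      by (intro pred_intros_finite borel_measurable_pred_less borel_measurable_sum borel_measurable_add
        measurable_component_singleton) auto
    show "k < T \<omega> \<longleftrightarrow> (\<forall>j\<in>{..k}. (\<Sum>i<j. a + (\<lambda>j\<in>UNIV \<times> {..<k}. Z j \<omega>) (True, i)) < l)" for \<omega>
      by (auto simp: T_def less_capped_passage_iff[OF k] estimate_def Z_def)
  qed
  then show ?thesis
    by (auto simp: predictable_def capped_passage_le) (simp add: T_def capped_passage_le)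
qed

lemma predictable_S: "predictable S"
proof -
  have "\<exists>P. Measurable.pred (PiM (UNIV \<times> {..<k}) (\<lambda>_. borel)) P \<and>
      (\<forall>\<omega>. k < S \<omega> \<longleftrightarrow> P (\<lambda>j\<in>UNIV \<times> {..<k}. Z j \<omega>))" if k: "k < K" for k
  proof (intro exI conjI allI)
    show "Measurable.pred (PiM (UNIV \<times> {..<k}) (\<lambda>_. borel))
        (\<lambda>x. \<forall>j\<in>{..k}. (\<Sum>i<j. a + x (True, i) + x (False, i)) < l)"
      by (intro pred_intros_finite borel_measurable_pred_less borel_measurable_sum borel_measurable_add
        measurable_component_singleton) auto
    show "k < S \<omega> \<longleftrightarrow> (\<forall>j\<in>{..k}. (\<Sum>i<j. a + (\<lambda>j\<in>UNIV \<times> {..<k}. Z j \<omega>) (True, i) +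
        (\<lambda>j\<in>UNIV \<times> {..<k}. Z j \<omega>) (False, i)) < l)" for \<omega>
      by (auto simp: S_def less_capped_passage_iff[OF k] signal_def Z_def)
  qed
  then show ?thesis
    by (auto simp: predictable_def) (simp add: S_def capped_passage_le)
qed

lemma integrable_bounded_nat:
  assumes "\<tau> \<in> M \<rightarrow>\<^sub>M count_space UNIV" "\<And>\<omega>. \<tau> \<omega> \<le> K"
  shows "integrable M (\<lambda>\<omega>. real (\<tau> \<omega>))"
  using assms by (intro integrable_const_bound[where B="real K"]) auto

text \<open>Trades a random number of summands for a fixed number with indicators, so that
  expectations can be taken term by term.\<close>

lemma sum_up_to_eq:
  fixes f :: "nat \<Rightarrow> real"
  assumes "n \<le> K"
  shows "(\<Sum>i<n. f i) = (\<Sum>i<K. of_bool (i < n) * f i)"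
proof -
  have "{..<K} \<inter> {i. i < n} = {..<n}"
    using assms by auto
  then show ?thesis
    by (simp add: of_bool_def if_distrib[of "\<lambda>x. x * _"] sum.If_cases cong: if_cong)
qed

text \<open>Optional stopping: \<open>k < \<tau>\<close> is decided by the increments before step
  \<open>k\<close>, so its indicator is independent of the centred variable \<open>Z (b, k)\<close>
  and every term has mean \<open>0\<close>.\<close>

lemma
  assumes \<tau>: "predictable \<tau>"
  shows integrable_predictable_sum: "integrable M (\<lambda>\<omega>. \<Sum>i<\<tau> \<omega>. Z (b, i) \<omega>)"
    and expectation_predictable_sum: "expectation (\<lambda>\<omega>. \<Sum>i<\<tau> \<omega>. Z (b, i) \<omega>) = 0"
proof -
  have le: "\<tau> \<omega> \<le> K" for \<omega>
    using \<tau> by (simp add: predictable_def)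
  have *: "integrable M (\<lambda>\<omega>. of_bool (k < \<tau> \<omega>) * Z (b, k) \<omega>)"
    "expectation (\<lambda>\<omega>. of_bool (k < \<tau> \<omega>) * Z (b, k) \<omega>) = 0" if k: "k < K" for k
  proof -
    from \<tau> k obtain P where P: "Measurable.pred (PiM (UNIV \<times> {..<k}) (\<lambda>_. borel)) P"
      and P_iff: "\<And>\<omega>. k < \<tau> \<omega> \<longleftrightarrow> P (\<lambda>j\<in>UNIV \<times> {..<k}. Z j \<omega>)"
      unfolding predictable_def by blast
    have [measurable]: "\<tau> \<in> M \<rightarrow>\<^sub>M count_space UNIV"
      using \<tau> by (simp add: predictable_def)
    have Zk: "integrable M (Z (b, k))" "expectation (Z (b, k)) = 0"
      using integrable_normal[OF normal_U \<sigma>_pos] integrable_normal[OF normal_V \<rho>_pos]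
        normal_distributed_expectation[OF \<sigma>_pos normal_U] normal_distributed_expectation[OF \<rho>_pos normal_V]
      by (auto simp: Z_def)
    have ind: "integrable M (\<lambda>\<omega>. of_bool (k < \<tau> \<omega>) :: real)"
      by (intro integrable_const_bound[where B=1]) auto
    have sub: "UNIV \<times> {..<k} \<subseteq> UNIV \<times> {..<K}"
      using k by auto
    have P': "(\<lambda>x. of_bool (P x) :: real) \<in> borel_measurable (PiM (UNIV \<times> {..<k}) (\<lambda>_. borel))"
      using P by measurable
    show "integrable M (\<lambda>\<omega>. of_bool (k < \<tau> \<omega>) * Z (b, k) \<omega>)"
      using integrable_mult_indep_blocks[OF indep_Z, of "UNIV \<times> {..<k}" "{(b, k)}" "\<lambda>x. of_bool (P x)" "\<lambda>x. x (b, k)"]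
        sub k Zk ind P' by (auto simp: P_iff)
    show "expectation (\<lambda>\<omega>. of_bool (k < \<tau> \<omega>) * Z (b, k) \<omega>) = 0"
      using expectation_mult_indep_blocks[OF indep_Z, of "UNIV \<times> {..<k}" "{(b, k)}" "\<lambda>x. of_bool (P x)" "\<lambda>x. x (b, k)"]
        sub k Zk ind P' by (auto simp: P_iff)
  qed
  show "integrable M (\<lambda>\<omega>. \<Sum>i<\<tau> \<omega>. Z (b, i) \<omega>)"
    unfolding sum_up_to_eq[OF le] by (intro Bochner_Integration.integrable_sum *) simp
  show "expectation (\<lambda>\<omega>. \<Sum>i<\<tau> \<omega>. Z (b, i) \<omega>) = 0"
    unfolding sum_up_to_eq[OF le] by (subst Bochner_Integration.integral_sum) (use * in auto)
qed

text \<open>Wald's identity. Both walks have drift \<open>a\<close> per step and centred noise, so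
  they share the identity, even at a time determined by both of them.\<close>

lemma
  assumes \<tau>: "predictable \<tau>"
  shows integrable_stopped_estimate: "integrable M (\<lambda>\<omega>. estimate (\<tau> \<omega>) \<omega>)"
    and expectation_stopped_estimate: "expectation (\<lambda>\<omega>. estimate (\<tau> \<omega>) \<omega>) = a * expectation (\<lambda>\<omega>. real (\<tau> \<omega>))"
    and integrable_stopped_signal: "integrable M (\<lambda>\<omega>. signal (\<tau> \<omega>) \<omega>)"
    and expectation_stopped_signal: "expectation (\<lambda>\<omega>. signal (\<tau> \<omega>) \<omega>) = a * expectation (\<lambda>\<omega>. real (\<tau> \<omega>))"
proof -
  have e: "estimate (\<tau> \<omega>) \<omega> = a * real (\<tau> \<omega>) + (\<Sum>i<\<tau> \<omega>. Z (True, i) \<omega>)" for \<omega>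
    by (simp add: estimate_def Z_def sum.distrib)
  have s: "signal (\<tau> \<omega>) \<omega> = a * real (\<tau> \<omega>) + (\<Sum>i<\<tau> \<omega>. Z (True, i) \<omega>) + (\<Sum>i<\<tau> \<omega>. Z (False, i) \<omega>)" for \<omega>
    by (simp add: signal_def Z_def sum.distrib)
  have int: "integrable M (\<lambda>\<omega>. real (\<tau> \<omega>))"
    using \<tau> by (intro integrable_bounded_nat) (auto simp: predictable_def)
  show "integrable M (\<lambda>\<omega>. estimate (\<tau> \<omega>) \<omega>)"
    "expectation (\<lambda>\<omega>. estimate (\<tau> \<omega>) \<omega>) = a * expectation (\<lambda>\<omega>. real (\<tau> \<omega>))"
    "integrable M (\<lambda>\<omega>. signal (\<tau> \<omega>) \<omega>)"
    "expectation (\<lambda>\<omega>. signal (\<tau> \<omega>) \<omega>) = a * expectation (\<lambda>\<omega>. real (\<tau> \<omega>))"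
    unfolding e s using int integrable_predictable_sum[OF \<tau>] expectation_predictable_sum[OF \<tau>] by simp_all
qed

section \<open>Overshoot, horizon shortfall and estimation error\<close>

definition overshoot :: "real \<Rightarrow> (nat \<Rightarrow> 'a \<Rightarrow> real) \<Rightarrow> 'a \<Rightarrow> real" where
  "overshoot \<theta> D \<omega> = a + (\<theta> + (\<Sum>i<K. D i \<omega> ^ 4) / \<theta> ^ 3)"

definition shortfall :: "'a \<Rightarrow> real" where
  "shortfall \<omega> = max 0 (l - signal K \<omega>)"

definition error :: "nat \<Rightarrow> 'a \<Rightarrow> real" where
  "error k \<omega> = max 0 (- (\<Sum>i<k. V i \<omega>))"

lemma T_le: "T \<omega> \<le> K"
  by (simp add: T_def capped_passage_le)

lemma S_le: "S \<omega> \<le> K"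
  by (simp add: S_def capped_passage_le)

lemma abs_le_overshoot:
  assumes "0 < \<theta>" "i < K"
  shows "a + \<bar>D i \<omega>\<bar> \<le> overshoot \<theta> D \<omega>"
  using abs_le_fourth_powers[OF assms, of "\<lambda>i. D i \<omega>"] by (simp add: overshoot_def)

lemma overshoot_nonneg:
  assumes "0 < \<theta>"
  shows "0 \<le> overshoot \<theta> D \<omega>"
  using assms a_pos by (auto simp: overshoot_def intro!: add_nonneg_nonneg sum_nonneg divide_nonneg_nonneg)

lemma estimate_at_T_le:
  assumes "0 < \<theta>"
  shows "estimate (T \<omega>) \<omega> \<le> l + overshoot \<theta> U \<omega>"
  unfolding T_def
proof (rule capped_passage_overshoot)
  show "estimate (Suc i) \<omega> \<le> estimate i \<omega> + overshoot \<theta> U \<omega>" if "i < K" for i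
    using abs_le_overshoot[OF assms that, of U \<omega>] by (simp add: estimate_def)
qed (use l_pos overshoot_nonneg[OF assms] in \<open>auto simp: estimate_def\<close>)

lemma signal_at_S_le:
  assumes "0 < \<theta>"
  shows "signal (S \<omega>) \<omega> \<le> l + overshoot \<theta> (\<lambda>i \<omega>. U i \<omega> + V i \<omega>) \<omega>"
  unfolding S_def
proof (rule capped_passage_overshoot)
  show "signal (Suc i) \<omega> \<le> signal i \<omega> + overshoot \<theta> (\<lambda>i \<omega>. U i \<omega> + V i \<omega>) \<omega>" if "i < K" for i
    using abs_le_overshoot[OF assms that, of "\<lambda>i \<omega>. U i \<omega> + V i \<omega>" \<omega>] by (simp add: signal_def)
qed (use l_pos overshoot_nonneg[OF assms] in \<open>auto simp: signal_def\<close>)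

text \<open>Below the cap the level has been reached and the shortfall is nonnegative; at the cap
  the shortfall is by definition what may be missing.\<close>

lemma signal_at_S_ge: "l - shortfall \<omega> \<le> signal (S \<omega>) \<omega>"
  using reached_at_capped_passage[of l K "\<lambda>k. signal k \<omega>", folded S_def]
  by (auto simp: shortfall_def)

text \<open>Stands in for a restart at \<open>T\<close>: from there the signal begins no lower than
  \<open>l - error (T \<omega>) \<omega>\<close> and stops no higher than \<open>l\<close> plus the
  overshoot. Wald's identity later converts this gain in space into mean extra time.\<close>

lemma signal_gain_after_T_le:
  assumes "0 < \<theta>"
  shows "signal (max (S \<omega>) (T \<omega>)) \<omega> - signal (T \<omega>) \<omega> \<le>
    overshoot \<theta> (\<lambda>i \<omega>. U i \<omega> + V i \<omega>) \<omega> + error (T \<omega>) \<omega>"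
proof (cases "T \<omega> < S \<omega>")
  case True
  \<comment> \<open>\<open>T < S \<le> K\<close> rules out that \<open>T\<close> is the cap, so the
    estimate has really reached \<open>l\<close> and contributes no shortfall.\<close>
  with S_le[of \<omega>] have "l \<le> estimate (T \<omega>) \<omega>"
    using reached_at_capped_passage[of l K "\<lambda>k. estimate k \<omega>", folded T_def] by auto
  moreover have "signal (T \<omega>) \<omega> = estimate (T \<omega>) \<omega> + (\<Sum>i<T \<omega>. V i \<omega>)"
    by (simp add: signal_def estimate_def sum.distrib)
  ultimately show ?thesis
    using True signal_at_S_le[OF assms, of \<omega>] by (simp add: error_def max_def)
next
  case False
  then show ?thesis
    using overshoot_nonneg[OF assms, of "\<lambda>i \<omega>. U i \<omega> + V i \<omega>" \<omega>] by (simp add: error_def max_def)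
qed

text \<open>An empty sum has no density, hence \<open>0 < k\<close>.\<close>

lemma normal_sum_Z:
  assumes "0 < k" "k \<le> K"
  shows "distributed M lborel (\<lambda>\<omega>. \<Sum>i<k. Z (b, i) \<omega>)
    (normal_density 0 (if b then \<sigma> * sqrt k else \<rho> * sqrt k))"
proof -
  let ?\<sigma> = "\<lambda>(b, i::nat). if b then \<sigma> else \<rho>"
  have "distributed M lborel (\<lambda>\<omega>. \<Sum>j\<in>{b} \<times> {..<k}. Z j \<omega>)
      (normal_density (\<Sum>j\<in>{b} \<times> {..<k}. 0) (sqrt (\<Sum>j\<in>{b} \<times> {..<k}. (?\<sigma> j)\<^sup>2)))"
  proof (rule sum_indep_normal)
    show "indep_vars (\<lambda>_. borel) Z ({b} \<times> {..<k})"
      using assms by (intro indep_vars_subset[OF indep_Z]) auto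
  qed (use assms \<sigma>_pos \<rho>_pos normal_U normal_V in \<open>auto simp: Z_def\<close>)
  then show ?thesis
    using \<sigma>_pos \<rho>_pos by (cases b) (simp_all add: sum.cartesian_product' real_sqrt_mult mult.commute)
qed

lemma
  assumes "k \<le> K"
  shows integrable_error: "integrable M (error k)"
    and expectation_error: "expectation (error k) = \<rho> * sqrt k / sqrt (2 * pi)"
proof -
  have "integrable M (error k) \<and> expectation (error k) = \<rho> * sqrt k / sqrt (2 * pi)"
  proof (cases "k = 0")
    case True
    then show ?thesis
      by (simp add: error_def[abs_def])
  next
    case False
    then have "distributed M lborel (\<lambda>\<omega>. \<Sum>i<k. V i \<omega>) (normal_density 0 (\<rho> * sqrt k))"
      using normal_sum_Z[of k False] assms by (simp add: Z_def)
    then show ?thesis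
      using integrable_normal_negpart expectation_normal_negpart False \<rho>_pos
      by (simp add: error_def[abs_def])
  qed
  then show "integrable M (error k)" "expectation (error k) = \<rho> * sqrt k / sqrt (2 * pi)"
    by auto
qed

text \<open>\<open>T\<close> is determined by the increments \<open>U\<close>, hence independent of the walk with increments \<open>V\<close>.\<close>
lemma
  assumes "k \<le> K"
  shows integrable_error_on_passage: "integrable M (\<lambda>\<omega>. of_bool (T \<omega> = k) * error k \<omega>)"
    and expectation_error_on_passage: "expectation (\<lambda>\<omega>. of_bool (T \<omega> = k) * error k \<omega>) =
      expectation (\<lambda>\<omega>. of_bool (T \<omega> = k)) * (\<rho> * sqrt k / sqrt (2 * pi))"
proof -
  let ?A = "{True} \<times> {..<k}" and ?B = "{False} \<times> {..<k}"
  let ?P = "\<lambda>x::bool \<times> nat \<Rightarrow> real. (k = K \<or> l \<le> (\<Sum>i<k. a + x (True, i))) \<and>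
    (\<forall>j\<in>{..<k}. (\<Sum>i<j. a + x (True, i)) < l)"
  let ?g = "\<lambda>x::bool \<times> nat \<Rightarrow> real. max 0 (- (\<Sum>i<k. x (False, i)))"
  have T: "T \<omega> = k \<longleftrightarrow> ?P (\<lambda>j\<in>?A. Z j \<omega>)" for \<omega>
    unfolding T_def capped_passage_eq_iff[OF assms] by (auto simp: estimate_def Z_def)
  have g: "?g (\<lambda>j\<in>?B. Z j \<omega>) = error k \<omega>" for \<omega>
    by (simp add: error_def Z_def)
  have [measurable]: "Measurable.pred (PiM ?A (\<lambda>_. borel)) ?P"
    by (intro pred_intros_logic pred_intros_finite borel_measurable_pred_less pred_le_const borel_measurable_sum borel_measurable_add
        measurable_component_singleton) auto
  have f_meas: "(\<lambda>x. of_bool (?P x) :: real) \<in> borel_measurable (PiM ?A (\<lambda>_. borel))"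
    by measurable
  have g_meas: "?g \<in> borel_measurable (PiM ?B (\<lambda>_. borel))"
    by (intro borel_measurable_max borel_measurable_uminus borel_measurable_sum measurable_component_singleton) auto
  have sub: "?A \<inter> ?B = {}" "?A \<subseteq> UNIV \<times> {..<K}" "?B \<subseteq> UNIV \<times> {..<K}"
    using assms by auto
  have int: "integrable M (\<lambda>\<omega>. of_bool (T \<omega> = k) :: real)"
    by (intro integrable_const_bound[where B=1]) auto
  show "integrable M (\<lambda>\<omega>. of_bool (T \<omega> = k) * error k \<omega>)"
    using integrable_mult_indep_blocks[OF indep_Z sub f_meas g_meas, folded T, unfolded g, OF int integrable_error[OF assms]] .
  show "expectation (\<lambda>\<omega>. of_bool (T \<omega> = k) * error k \<omega>) =
      expectation (\<lambda>\<omega>. of_bool (T \<omega> = k)) * (\<rho> * sqrt k / sqrt (2 * pi))"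
    using expectation_mult_indep_blocks[OF indep_Z sub f_meas g_meas, folded T, unfolded g, OF int integrable_error[OF assms]]
    unfolding expectation_error[OF assms] .
qed

text \<open>Splitting by the value of \<open>T\<close> reduces the mean error to the mean of
  \<open>sqrt T\<close>. In place of Jensen's inequality the tangent bound
  \<open>sqrt t \<le> (t / q + q) / 2\<close> is used: it is linear in \<open>t\<close>, so a bound
  on the mean of \<open>T\<close> can be inserted later, and \<open>q\<close> equal to the square
  root of that mean recovers Jensen's value.\<close>

lemma
  assumes "0 < q"
  shows integrable_stopped_error: "integrable M (\<lambda>\<omega>. error (T \<omega>) \<omega>)"
    and expectation_stopped_error_le:
      "expectation (\<lambda>\<omega>. error (T \<omega>) \<omega>) \<le> \<rho> / sqrt (2 * pi) * ((expectation (\<lambda>\<omega>. real (T \<omega>)) / q + q) / 2)"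
proof -
  have pick: "f (T \<omega>) = (\<Sum>k\<le>K. of_bool (T \<omega> = k) * f k)" for f :: "nat \<Rightarrow> real" and \<omega>
  proof -
    show ?thesis
      using T_le[of \<omega>] by (simp add: of_bool_def if_distrib[of "\<lambda>x. x * _"] sum.delta cong: if_cong)
  qed
  have int: "integrable M (\<lambda>\<omega>. of_bool (T \<omega> = k) :: real)" for k
    by (intro integrable_const_bound[where B=1]) auto
  show "integrable M (\<lambda>\<omega>. error (T \<omega>) \<omega>)"
    unfolding pick[of "\<lambda>k. error k _"]
    by (intro Bochner_Integration.integrable_sum integrable_error_on_passage) simp
  have "expectation (\<lambda>\<omega>. error (T \<omega>) \<omega>) = (\<Sum>k\<le>K. expectation (\<lambda>\<omega>. of_bool (T \<omega> = k) * error k \<omega>))"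
    unfolding pick[of "\<lambda>k. error k _"]
    by (intro Bochner_Integration.integral_sum integrable_error_on_passage) simp
  also have "\<dots> = (\<Sum>k\<le>K. expectation (\<lambda>\<omega>. of_bool (T \<omega> = k) * (\<rho> * sqrt k / sqrt (2 * pi))))"
    by (intro sum.cong) (auto simp: expectation_error_on_passage)
  also have "\<dots> = expectation (\<lambda>\<omega>. \<rho> * sqrt (real (T \<omega>)) / sqrt (2 * pi))"
    unfolding pick[of "\<lambda>k. \<rho> * sqrt (real k) / sqrt (2 * pi)"]
    by (intro Bochner_Integration.integral_sum[symmetric] integrable_mult_left) (rule int)
  also have "\<dots> \<le> expectation (\<lambda>\<omega>. \<rho> / sqrt (2 * pi) * ((real (T \<omega>) / q + q) / 2))"
  proof (rule integral_mono)
    show "integrable M (\<lambda>\<omega>. \<rho> * sqrt (real (T \<omega>)) / sqrt (2 * pi))"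
      unfolding pick[of "\<lambda>k. \<rho> * sqrt (real k) / sqrt (2 * pi)"]
      by (intro Bochner_Integration.integrable_sum integrable_mult_left) (rule int)
    show "integrable M (\<lambda>\<omega>. \<rho> / sqrt (2 * pi) * ((real (T \<omega>) / q + q) / 2))"
      by (intro integrable_mult_right integrable_divide Bochner_Integration.integrable_add integrable_bounded_nat) (auto simp: T_le)
    have "sqrt t \<le> (t / q + q) / 2" if "0 \<le> t" for t
      using arith_geo_mean_sqrt[of "t / q" q] assms that by simp
    from this[of "real (T \<omega>)" for \<omega>] have "\<rho> / sqrt (2 * pi) * sqrt (real (T \<omega>)) \<le>
        \<rho> / sqrt (2 * pi) * ((real (T \<omega>) / q + q) / 2)" for \<omega>
      using \<rho>_pos by (intro mult_left_mono) auto
    then show "\<rho> * sqrt (real (T \<omega>)) / sqrt (2 * pi) \<le> \<rho> / sqrt (2 * pi) * ((real (T \<omega>) / q + q) / 2)" for \<omega>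
      by simp
  qed
  also have "\<dots> = \<rho> / sqrt (2 * pi) * ((expectation (\<lambda>\<omega>. real (T \<omega>)) / q + q) / 2)"
    using integrable_bounded_nat[of T] by (simp add: T_le prob_space)
  finally show "expectation (\<lambda>\<omega>. error (T \<omega>) \<omega>) \<le> \<rho> / sqrt (2 * pi) * ((expectation (\<lambda>\<omega>. real (T \<omega>)) / q + q) / 2)" .
qed

lemma
  fixes D :: "nat \<Rightarrow> 'a \<Rightarrow> real" and m :: real
  assumes "0 < \<theta>" and int: "\<And>i. integrable M (\<lambda>\<omega>. D i \<omega> ^ 4)"
    and m: "\<And>i. expectation (\<lambda>\<omega>. D i \<omega> ^ 4) \<le> m"
  shows integrable_overshoot: "integrable M (overshoot \<theta> D)"
    and expectation_overshoot_le: "expectation (overshoot \<theta> D) \<le> a + (\<theta> + K * m / \<theta> ^ 3)"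
proof -
  show "integrable M (overshoot \<theta> D)"
    using int by (simp add: overshoot_def[abs_def])
  have "(\<Sum>i<K. expectation (\<lambda>\<omega>. D i \<omega> ^ 4)) \<le> K * m"
    using sum_bounded_above[of "{..<K}" "\<lambda>i. expectation (\<lambda>\<omega>. D i \<omega> ^ 4)" m] m by simp
  then show "expectation (overshoot \<theta> D) \<le> a + (\<theta> + K * m / \<theta> ^ 3)"
    using int assms(1) by (simp add: overshoot_def[abs_def] prob_space divide_right_mono)
qed

text \<open>The constant is \<open>24 = 8 * 3\<close>, with \<open>8\<close> from
  \<open>fourth_power_add_le\<close> and \<open>3\<close> from the normal fourth moment. The case
  \<open>c = 1\<close> serves a single step, \<open>c = sqrt K\<close> the endpoint of the
  walk.\<close>

lemma
  assumes X: "distributed M lborel X (normal_density 0 (\<sigma> * c))" and Y: "distributed M lborel Y (normal_density 0 (\<rho> * c))"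
    and "0 < c"
  shows integrable_pow4_add: "integrable M (\<lambda>\<omega>. (X \<omega> + Y \<omega>) ^ 4)"
    and expectation_pow4_add_le: "expectation (\<lambda>\<omega>. (X \<omega> + Y \<omega>) ^ 4) \<le> 24 * (\<sigma> ^ 4 + \<rho> ^ 4) * c ^ 4"
proof -
  have pos: "0 < \<sigma> * c" "0 < \<rho> * c"
    using \<open>0 < c\<close> \<sigma>_pos \<rho>_pos by auto
  have [measurable]: "X \<in> borel_measurable M" "Y \<in> borel_measurable M"
    using X Y by (auto simp: distributed_def)
  have int: "integrable M (\<lambda>\<omega>. 8 * (X \<omega> ^ 4 + Y \<omega> ^ 4))"
    using integrable_normal_pow4[OF X pos(1)] integrable_normal_pow4[OF Y pos(2)] by simp
  show int2: "integrable M (\<lambda>\<omega>. (X \<omega> + Y \<omega>) ^ 4)"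
    by (rule Bochner_Integration.integrable_bound[OF int])
      (use fourth_power_add_le in \<open>auto simp: abs_of_nonneg simp del: distrib_left_numeral intro!: AE_I2\<close>)
  have "expectation (\<lambda>\<omega>. (X \<omega> + Y \<omega>) ^ 4) \<le> expectation (\<lambda>\<omega>. 8 * (X \<omega> ^ 4 + Y \<omega> ^ 4))"
    by (intro integral_mono int int2 fourth_power_add_le)
  also have "\<dots> = 24 * (\<sigma> ^ 4 + \<rho> ^ 4) * c ^ 4"
    using integrable_normal_pow4[OF X pos(1)] integrable_normal_pow4[OF Y pos(2)]
      expectation_normal_pow4[OF X pos(1)] expectation_normal_pow4[OF Y pos(2)]
    by (simp add: power_mult_distrib algebra_simps)
  finally show "expectation (\<lambda>\<omega>. (X \<omega> + Y \<omega>) ^ 4) \<le> 24 * (\<sigma> ^ 4 + \<rho> ^ 4) * c ^ 4" .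
qed

text \<open>At the horizon the drift has carried the mean to \<open>a * K\<close>, so a shortfall
  needs a deviation of more than \<open>a * K - l\<close>, whose size is measured by the fourth
  moment.\<close>

lemma
  assumes "l < a * K"
  shows integrable_shortfall: "integrable M shortfall"
    and expectation_shortfall_le:
      "expectation shortfall \<le> 24 * (\<sigma> ^ 4 + \<rho> ^ 4) * (real K)\<^sup>2 / (a * K - l) ^ 3"
proof -
  have K: "0 < K"
    using assms l_pos a_pos by (cases K) auto
  let ?W = "\<lambda>\<omega>. (\<Sum>i<K. Z (True, i) \<omega>) + (\<Sum>i<K. Z (False, i) \<omega>)"
  have W: "integrable M (\<lambda>\<omega>. ?W \<omega> ^ 4)"
    "expectation (\<lambda>\<omega>. ?W \<omega> ^ 4) \<le> 24 * (\<sigma> ^ 4 + \<rho> ^ 4) * sqrt K ^ 4"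
    using normal_sum_Z[of K True] normal_sum_Z[of K False] K
    by (auto intro!: integrable_pow4_add expectation_pow4_add_le simp del: distrib_left_numeral)
  have le: "shortfall \<omega> \<le> ?W \<omega> ^ 4 / (a * K - l) ^ 3" for \<omega>
  proof -
    have neg: "(- x) ^ 4 = x ^ 4" for x :: real
      by simp
    have eq: "shortfall \<omega> = max 0 (- ?W \<omega> - (a * K - l))"
      by (simp add: shortfall_def signal_def Z_def sum.distrib algebra_simps)
    show ?thesis
      using positive_part_le_fourth_power[of "a * K - l" "- ?W \<omega>"] assms unfolding eq neg by simp
  qed
  have [measurable]: "shortfall \<in> borel_measurable M"
    by (simp add: shortfall_def[abs_def])
  show int: "integrable M shortfall"
    by (rule Bochner_Integration.integrable_bound[OF integrable_divide[OF W(1), of "(a * K - l) ^ 3"]])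
      (use le assms in \<open>auto simp: shortfall_def intro!: AE_I2\<close>)
  have "expectation shortfall \<le> expectation (\<lambda>\<omega>. ?W \<omega> ^ 4 / (a * K - l) ^ 3)"
    by (intro integral_mono int integrable_divide W(1) le)
  also have "\<dots> \<le> 24 * (\<sigma> ^ 4 + \<rho> ^ 4) * sqrt K ^ 4 / (a * K - l) ^ 3"
    using W(2) assms by (simp add: divide_right_mono)
  also have "sqrt K ^ 4 = (real K)\<^sup>2"
    using power_mult[of "sqrt K" 2 2] by simp
  finally show "expectation shortfall \<le> 24 * (\<sigma> ^ 4 + \<rho> ^ 4) * (real K)\<^sup>2 / (a * K - l) ^ 3" .
qed

text \<open>Combines Wald's identity for \<open>max S T\<close>, \<open>T\<close> and
  \<open>S\<close>. Of \<open>3 * e\<close>, two parts are the doubled overshoot of the signal and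
  one is the overshoot of the estimate in the upper bound for \<open>T\<close>; \<open>r\<close>
  comes from the lower bound for \<open>S\<close>. The doubled error cancels the \<open>2\<close> of
  the tangent bound.\<close>

lemma expectation_passage_difference_le:
  assumes \<theta>: "0 < \<theta>" and q: "0 < q" and K: "l < a * K"
  defines "e \<equiv> a + (\<theta> + K * (24 * (\<sigma> ^ 4 + \<rho> ^ 4)) / \<theta> ^ 3)"
    and "r \<equiv> 24 * (\<sigma> ^ 4 + \<rho> ^ 4) * (real K)\<^sup>2 / (a * K - l) ^ 3"
  shows "a * expectation (\<lambda>\<omega>. \<bar>real (T \<omega>) - real (S \<omega>)\<bar>) \<le>
    \<rho> / sqrt (2 * pi) * ((l + e) / (a * q) + q) + 3 * e + r"
proof -
  let ?O1 = "overshoot \<theta> (\<lambda>i \<omega>. U i \<omega> + V i \<omega>)" and ?O2 = "overshoot \<theta> U"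
  \<comment> \<open>Deliberately crude, so that one \<open>e\<close> serves the overshoots of both
    walks.\<close>
  have U4: "integrable M (\<lambda>\<omega>. U i \<omega> ^ 4)" "expectation (\<lambda>\<omega>. U i \<omega> ^ 4) \<le> 24 * (\<sigma> ^ 4 + \<rho> ^ 4)" for i
    using integrable_normal_pow4[OF normal_U \<sigma>_pos] expectation_normal_pow4[OF normal_U \<sigma>_pos, of i] \<sigma>_pos \<rho>_pos
    by (auto intro!: add_mono)
  have UV4: "integrable M (\<lambda>\<omega>. (U i \<omega> + V i \<omega>) ^ 4)"
    "expectation (\<lambda>\<omega>. (U i \<omega> + V i \<omega>) ^ 4) \<le> 24 * (\<sigma> ^ 4 + \<rho> ^ 4)" for i
    using integrable_pow4_add[of "U i" 1 "V i"] expectation_pow4_add_le[of "U i" 1 "V i"] normal_U normal_V by auto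
  have O1: "integrable M ?O1" "expectation ?O1 \<le> e"
    unfolding e_def by (rule integrable_overshoot[OF \<theta> UV4] expectation_overshoot_le[OF \<theta> UV4])+
  have O2: "integrable M ?O2" "expectation ?O2 \<le> e"
    unfolding e_def by (rule integrable_overshoot[OF \<theta> U4] expectation_overshoot_le[OF \<theta> U4])+
  have R: "integrable M shortfall" "expectation shortfall \<le> r"
    unfolding r_def by (rule integrable_shortfall[OF K] expectation_shortfall_le[OF K])+
  note max_ST = predictable_max[OF predictable_S predictable_T]
  note int = integrable_stopped_signal[OF max_ST] integrable_stopped_signal[OF predictable_T]
    integrable_stopped_signal[OF predictable_S] integrable_stopped_estimate[OF predictable_T]
    integrable_bounded_nat[OF measurable_T T_le] integrable_bounded_nat[OF measurable_S S_le]
    integrable_stopped_error[OF q] O1(1) O2(1) R(1)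
  note wald = expectation_stopped_signal[OF max_ST] expectation_stopped_signal[OF predictable_T]
    expectation_stopped_signal[OF predictable_S] expectation_stopped_estimate[OF predictable_T]
  have int_max: "integrable M (\<lambda>\<omega>. real (max (S \<omega>) (T \<omega>)))"
    using max_ST by (intro integrable_bounded_nat) (auto simp: predictable_def)
  have "a * expectation (\<lambda>\<omega>. real (T \<omega>)) \<le> expectation (\<lambda>\<omega>. l + ?O2 \<omega>)"
    unfolding wald(4)[symmetric] using int by (intro integral_mono estimate_at_T_le[OF \<theta>]) auto
  then have T: "a * expectation (\<lambda>\<omega>. real (T \<omega>)) \<le> l + e"
    using O2 by (simp add: prob_space)
  have S: "l - r \<le> a * expectation (\<lambda>\<omega>. real (S \<omega>))"
  proof -
    have "expectation (\<lambda>\<omega>. l - shortfall \<omega>) \<le> a * expectation (\<lambda>\<omega>. real (S \<omega>))"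
      unfolding wald(3)[symmetric] using int by (intro integral_mono signal_at_S_ge) auto
    then show ?thesis
      using R by (simp add: prob_space)
  qed
  have "expectation (\<lambda>\<omega>. signal (max (S \<omega>) (T \<omega>)) \<omega> - signal (T \<omega>) \<omega>) \<le>
      expectation (\<lambda>\<omega>. ?O1 \<omega> + error (T \<omega>) \<omega>)"
    using int by (intro integral_mono signal_gain_after_T_le[OF \<theta>]) auto
  then have gain: "a * expectation (\<lambda>\<omega>. real (max (S \<omega>) (T \<omega>))) - a * expectation (\<lambda>\<omega>. real (T \<omega>)) \<le>
      e + expectation (\<lambda>\<omega>. error (T \<omega>) \<omega>)"
    using int wald O1 by simp
  have "expectation (\<lambda>\<omega>. real (T \<omega>)) / q \<le> (l + e) / (a * q)"
    using T a_pos q by (simp add: field_simps)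
  then have "\<rho> / sqrt (2 * pi) * ((expectation (\<lambda>\<omega>. real (T \<omega>)) / q + q) / 2) \<le>
      \<rho> / sqrt (2 * pi) * (((l + e) / (a * q) + q) / 2)"
    using \<rho>_pos by (intro mult_left_mono divide_right_mono add_right_mono) auto
  then have "2 * expectation (\<lambda>\<omega>. error (T \<omega>) \<omega>) \<le> 2 * (\<rho> / sqrt (2 * pi) * (((l + e) / (a * q) + q) / 2))"
    using expectation_stopped_error_le[OF q] by linarith
  then have err: "2 * expectation (\<lambda>\<omega>. error (T \<omega>) \<omega>) \<le> \<rho> / sqrt (2 * pi) * ((l + e) / (a * q) + q)"
    by simp
  have "\<bar>real (T \<omega>) - real (S \<omega>)\<bar> = 2 * real (max (S \<omega>) (T \<omega>)) - real (T \<omega>) - real (S \<omega>)" for \<omega>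
    by (simp add: max_def)
  then have "expectation (\<lambda>\<omega>. \<bar>real (T \<omega>) - real (S \<omega>)\<bar>) =
      2 * expectation (\<lambda>\<omega>. real (max (S \<omega>) (T \<omega>))) - expectation (\<lambda>\<omega>. real (T \<omega>)) - expectation (\<lambda>\<omega>. real (S \<omega>))"
    using int int_max by simp
  then have "a * expectation (\<lambda>\<omega>. \<bar>real (T \<omega>) - real (S \<omega>)\<bar>) = a *
      (2 * expectation (\<lambda>\<omega>. real (max (S \<omega>) (T \<omega>))) - expectation (\<lambda>\<omega>. real (T \<omega>)) - expectation (\<lambda>\<omega>. real (S \<omega>)))"
    by (rule arg_cong)
  also have "\<dots> =
      2 * (a * expectation (\<lambda>\<omega>. real (max (S \<omega>) (T \<omega>))) - a * expectation (\<lambda>\<omega>. real (T \<omega>)))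
      + a * expectation (\<lambda>\<omega>. real (T \<omega>)) - a * expectation (\<lambda>\<omega>. real (S \<omega>))"
    by (simp add: algebra_simps)
  finally show ?thesis
    using gain T S err by simp
qed

end

section \<open>From the grid to continuous time\<close>

text \<open>By continuity the times at or above the level form a closed set, so the infimum is
  attained. This replaces the \<open>ereal\<close> value by a real time with the two properties on
  which the grid approximation rests.\<close>

lemma first_passage_time_attained:
  fixes Z :: "real \<Rightarrow> 'a \<Rightarrow> real"
  assumes cont: "continuous_on {0..} (\<lambda>t. Z t \<omega>)" and ex: "\<exists>t\<ge>0. l \<le> Z t \<omega>"
  obtains t where "first_passage_time l Z \<omega> = ereal t" "0 \<le> t" "l \<le> Z t \<omega>"
    "\<And>u. 0 \<le> u \<Longrightarrow> u < t \<Longrightarrow> Z u \<omega> < l"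
proof -
  let ?A = "{t. 0 \<le> t \<and> l \<le> Z t \<omega>}"
  have "?A = {t \<in> {0..}. l \<le> Z t \<omega>}"
    by auto
  also have "closed \<dots>"
    by (intro continuous_on_closed_Collect_le continuous_on_const cont) simp
  finally have closed: "closed ?A" .
  have bdd: "bdd_below ?A"
    by (auto intro!: bdd_belowI[of _ 0])
  have mem: "Inf ?A \<in> ?A"
    using ex by (intro closed_contains_Inf bdd closed) auto
  have lower: "Inf ?A \<le> u" if "u \<in> ?A" for u
    by (rule cInf_lower[OF that bdd])
  show thesis
  proof (rule that[of "Inf ?A"])
    show "first_passage_time l Z \<omega> = ereal (Inf ?A)"
      unfolding first_passage_time_def
      by (intro antisym INF_lower INF_greatest mem) (use lower in auto)
    show "Z u \<omega> < l" if "0 \<le> u" "u < Inf ?A" for u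
      using lower[of u] that by force
  qed (use mem in auto)
qed

text \<open>On the compact interval up to \<open>t - e\<close> the path has a maximum strictly below
  \<open>l\<close>. Once \<open>l - a\<close> exceeds it, no grid point there can stop the walk,
  whatever the mesh; \<open>t \<le> \<delta> * real K\<close> keeps the cap out of the way.\<close>

lemma grid_passage_ge:
  fixes x :: "real \<Rightarrow> real"
  assumes cont: "continuous_on {0..} x" and below: "\<And>u. 0 \<le> u \<Longrightarrow> u < t \<Longrightarrow> x u < l" and "0 < e"
  obtains a0 where "0 < a0"
    "\<And>a \<delta> K. a < a0 \<Longrightarrow> 0 < \<delta> \<Longrightarrow> t \<le> \<delta> * real K \<Longrightarrow>
      t - e \<le> \<delta> * real (capped_passage (l - a) K (\<lambda>k. x (real k * \<delta>)))"
proof (cases "0 \<le> t - e")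
  case False
  show thesis
  proof (rule that[of 1])
    fix a \<delta> :: real and K assume "0 < \<delta>"
    then have "0 \<le> \<delta> * real (capped_passage (l - a) K (\<lambda>k. x (real k * \<delta>)))"
      by simp
    then show "t - e \<le> \<delta> * real (capped_passage (l - a) K (\<lambda>k. x (real k * \<delta>)))"
      using False by linarith
  qed simp
next
  case True
  have "continuous_on {0..t - e} x"
    using cont by (rule continuous_on_subset) auto
  then obtain v where v: "v \<in> {0..t - e}" "\<And>u. u \<in> {0..t - e} \<Longrightarrow> x u \<le> x v"
    using continuous_attains_sup[of "{0..t - e}" x] True by auto
  show thesis
  proof (rule that[of "l - x v"])
    show "0 < l - x v"
      using below[of v] v(1) \<open>0 < e\<close> by simp
    fix a \<delta> :: real and K assume *: "a < l - x v" "0 < \<delta>" "t \<le> \<delta> * real K"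
    let ?c = "capped_passage (l - a) K (\<lambda>k. x (real k * \<delta>))"
    show "t - e \<le> \<delta> * real ?c"
    proof (rule ccontr)
      assume less: "\<not> t - e \<le> \<delta> * real ?c"
      then have "?c \<noteq> K"
        using * \<open>0 < e\<close> by auto
      then have "l - a \<le> x (real ?c * \<delta>)"
        using reached_at_capped_passage[of "l - a" K "\<lambda>k. x (real k * \<delta>)"] by simp
      moreover have "x (real ?c * \<delta>) \<le> x v"
        using less * by (intro v) (auto simp: mult.commute)
      ultimately show False
        using * by simp
    qed
  qed
qed

text \<open>The path lies above \<open>l - a\<close> on a whole neighbourhood of \<open>t\<close>,
  so a fine grid has a point in it not later than \<open>t\<close>. A small cap can only stop the
  walk earlier.\<close>

lemma grid_passage_le:
  fixes x :: "real \<Rightarrow> real"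
  assumes cont: "continuous_on {0..} x" and t: "0 \<le> t" "l \<le> x t" and a: "0 < a"
  obtains d where "0 < d"
    "\<And>\<delta> K. 0 < \<delta> \<Longrightarrow> \<delta> < d \<Longrightarrow> \<delta> * real (capped_passage (l - a) K (\<lambda>k. x (real k * \<delta>))) \<le> t"
proof -
  from cont t a obtain d where d: "0 < d" "\<And>u. 0 \<le> u \<Longrightarrow> dist u t < d \<Longrightarrow> dist (x u) (x t) < a"
    unfolding continuous_on_iff by (metis atLeast_iff)
  show thesis
  proof (rule that[OF d(1)])
    fix \<delta> :: real and K assume \<delta>: "0 < \<delta>" "\<delta> < d"
    \<comment> \<open>The last grid point not after \<open>t\<close>, at distance less than
      \<open>\<delta>\<close> from it.\<close>
    define k where "k = nat \<lfloor>t / \<delta>\<rfloor>"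
    have k: "real k \<le> t / \<delta>" "t / \<delta> < real k + 1"
      using t \<delta> unfolding k_def by (auto simp: of_nat_floor)
    then have k': "real k * \<delta> \<le> t" "t < real k * \<delta> + \<delta>"
      using \<delta> by (simp_all add: field_simps)
    then have "dist (x (real k * \<delta>)) (x t) < a"
      using \<delta> by (intro d) (auto simp: dist_real_def)
    then have "l - a \<le> x (real k * \<delta>)"
      using t by (simp add: dist_real_def)
    then have "capped_passage (l - a) K (\<lambda>k. x (real k * \<delta>)) \<le> k"
      by (rule capped_passage_le_if_reached)
    then have "\<delta> * real (capped_passage (l - a) K (\<lambda>k. x (real k * \<delta>))) \<le> \<delta> * real k"
      using \<delta> by simp
    also have "\<dots> \<le> t"
      using k' by (simp add: mult.commute)
    finally show "\<delta> * real (capped_passage (l - a) K (\<lambda>k. x (real k * \<delta>))) \<le> t" .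
  qed
qed

text \<open>The mesh demanded by \<open>grid_passage_le\<close> depends on the level
  \<open>l - a m\<close>, whereas \<open>a0\<close> from \<open>grid_passage_ge\<close> is uniform
  in the mesh. Hence the iterated limit: the grid is refined at a fixed level before the level is
  raised to \<open>l\<close>.\<close>

lemma grid_passage_approx:
  fixes x :: "real \<Rightarrow> real" and \<delta> :: "nat \<Rightarrow> real" and K :: "nat \<Rightarrow> nat"
  assumes cont: "continuous_on {0..} x" and t: "0 \<le> t" "l \<le> x t"
    and below: "\<And>u. 0 \<le> u \<Longrightarrow> u < t \<Longrightarrow> x u < l" and "0 < e"
    and \<delta>: "\<And>n. 0 < \<delta> n" "\<delta> \<longlonglongrightarrow> 0" and K: "filterlim (\<lambda>n. \<delta> n * real (K n)) at_top sequentially"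
    and a: "\<And>m. 0 < a m" "a \<longlonglongrightarrow> 0"
  shows "\<forall>\<^sub>F m in sequentially. \<forall>\<^sub>F n in sequentially.
    \<bar>\<delta> n * real (capped_passage (l - a m) (K n) (\<lambda>k. x (real k * \<delta> n))) - t\<bar> \<le> e"
proof -
  obtain a0 where a0: "0 < a0" "\<And>a \<delta> K. a < a0 \<Longrightarrow> 0 < \<delta> \<Longrightarrow> t \<le> \<delta> * real K \<Longrightarrow>
      t - e \<le> \<delta> * real (capped_passage (l - a) K (\<lambda>k. x (real k * \<delta>)))"
    using grid_passage_ge[OF cont below \<open>0 < e\<close>] by blast
  have "\<forall>\<^sub>F m in sequentially. a m < a0"
    using order_tendstoD(2)[OF a(2) a0(1)] .
  then show ?thesis
  proof eventually_elim
    case (elim m)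
    obtain d where d: "0 < d" "\<And>\<delta> K. 0 < \<delta> \<Longrightarrow> \<delta> < d \<Longrightarrow>
        \<delta> * real (capped_passage (l - a m) K (\<lambda>k. x (real k * \<delta>))) \<le> t"
      using grid_passage_le[OF cont t a(1)] by blast
    have "\<forall>\<^sub>F n in sequentially. \<delta> n < d"
      using order_tendstoD(2)[OF \<delta>(2) d(1)] .
    moreover have "\<forall>\<^sub>F n in sequentially. t \<le> \<delta> n * real (K n)"
      using K by (simp add: filterlim_at_top)
    ultimately show ?case
    proof eventually_elim
      case (elim n)
      then show ?case
        using a0(2)[OF \<open>a m < a0\<close> \<delta>(1)[of n], of "K n"] d(2)[OF \<delta>(1)[of n], of "K n"] \<open>0 < e\<close>
        by (simp add: abs_le_iff)
    qed
  qed
qed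

text \<open>Staying below \<open>l\<close> forever forces
  \<open>\<bar>W n\<bar> \<ge> s * n - l\<close> for every positive \<open>n\<close>, and
  Chebyshev's inequality gives this a probability of order \<open>1 / n\<close>.\<close>

lemma (in prob_space) AE_normal_with_drift_reaches:
  fixes W :: "nat \<Rightarrow> 'a \<Rightarrow> real"
  assumes W: "\<And>n. 0 < n \<Longrightarrow> distributed M lborel (W n) (normal_density 0 (\<sigma> * sqrt n))"
    and \<sigma>: "0 < \<sigma>" and s: "0 < s"
  shows "AE \<omega> in M. \<exists>n>0. l \<le> s * real n + W n \<omega>"
proof -
  \<comment> \<open>\<open>W 0\<close> is unconstrained; replacing it by \<open>0\<close> makes the
    whole sequence measurable.\<close>
  define W' where "W' n = (if n = 0 then (\<lambda>_. 0) else W n)" for n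
  have W'[measurable]: "W' n \<in> borel_measurable M" for n
    using W[of n] by (auto simp: W'_def distributed_def)
  define E where "E = {\<omega> \<in> space M. \<forall>n>0. \<not> l \<le> s * real n + W' n \<omega>}"
  have E: "E \<in> events"
    unfolding E_def by measurable
  have bound: "\<forall>\<^sub>F n in sequentially. prob E \<le> \<sigma>\<^sup>2 * real n / (s * real n - l)\<^sup>2"
  proof -
    have "filterlim (\<lambda>n. s * real n) at_top sequentially"
      using s by real_asymp
    then have "\<forall>\<^sub>F n in sequentially. l < s * real n"
      by (simp add: filterlim_at_top_dense)
    then show ?thesis
      using eventually_gt_at_top[of 0]
    proof eventually_elim
      case (elim n)
      have D: "distributed M lborel (W' n) (normal_density 0 (\<sigma> * sqrt n))"
        using W elim by (simp add: W'_def)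
      have pos: "0 < \<sigma> * sqrt n"
        using \<sigma> elim by simp
      have "prob E \<le> prob {\<omega> \<in> space M. \<bar>W' n \<omega>\<bar> \<ge> s * real n - l}"
        using elim by (intro finite_measure_mono) (auto simp: E_def dest!: spec[of _ n])
      also have "\<dots> \<le> expectation (\<lambda>\<omega>. (W' n \<omega>)\<^sup>2) / (s * real n - l)\<^sup>2"
        using integrable_normal_moment[OF pos, of 0 2] distributed_integrable[OF D, of "\<lambda>x. x\<^sup>2"] elim
        by (intro second_moment_method) auto
      also have "expectation (\<lambda>\<omega>. (W' n \<omega>)\<^sup>2) = \<sigma>\<^sup>2 * real n"
        using normal_distributed_variance[OF pos D] normal_distributed_expectation[OF pos D]
        by (simp add: power_mult_distrib)
      finally show ?case .
    qed
  qed
  have "(\<lambda>n. \<sigma>\<^sup>2 * real n / (s * real n - l)\<^sup>2) \<longlonglongrightarrow> 0"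
    using s \<sigma> by real_asymp
  then have "prob E \<le> 0"
    using bound by (rule tendsto_lowerbound) simp
  then have "prob E = 0"
    by (simp add: measure_le_0_iff)
  then have "AE \<omega> in M. \<omega> \<notin> E"
    using E by (simp add: AE_iff_measurable[OF E] prob_eq_0)
  then show ?thesis
  proof (rule AE_mp)
    show "AE \<omega> in M. \<omega> \<notin> E \<longrightarrow> (\<exists>n>0. l \<le> s * real n + W n \<omega>)"
      by (rule AE_I2) (auto simp: E_def W'_def)
  qed
qed

text \<open>Passes from numbers of steps to time. Here \<open>l\<close> will be a lowered level and
  \<open>L\<close> an upper bound for it, which makes the estimate uniform over all lowered
  levels.\<close>

lemma (in gaussian_walks) scaled_expectation_passage_difference_le:
  fixes c s \<delta> \<theta> L :: real
  assumes pos: "0 < s" "0 < \<delta>" "0 < c" "0 < \<theta>" and a: "a = s * \<delta>" and \<rho>: "\<rho> = c * sqrt \<delta>"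
    and var: "\<sigma>\<^sup>2 + \<rho>\<^sup>2 = \<delta>" and L: "l \<le> L" "L < s * \<delta> * real K"
  defines "e \<equiv> s * \<delta> + \<theta> + 24 * real K * \<delta>\<^sup>2 / \<theta> ^ 3"
    and "r \<equiv> 24 * (\<delta> * K)\<^sup>2 / (s * \<delta> * real K - L) ^ 3"
  shows "expectation (\<lambda>\<omega>. \<bar>\<delta> * real (T \<omega>) - \<delta> * real (S \<omega>)\<bar>) \<le>
    (c / sqrt (2 * pi) * (2 * sqrt (L / s) + e / sqrt (L * s)) + 3 * e + r) / s"
proof -
  define e0 where "e0 = a + (\<theta> + K * (24 * (\<sigma> ^ 4 + \<rho> ^ 4)) / \<theta> ^ 3)"
  define r0 where "r0 = 24 * (\<sigma> ^ 4 + \<rho> ^ 4) * (real K)\<^sup>2 / (a * K - l) ^ 3"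
  \<comment> \<open>Up to the overshoot, \<open>L / (s * \<delta>)\<close> bounds the mean number of
    steps; its square root is the best \<open>q\<close> in the tangent bound.\<close>
  define q where "q = sqrt (L / s) / sqrt \<delta>"
  have L_pos: "0 < L"
    using l_pos L by simp
  have q: "0 < q"
    using L_pos pos by (simp add: q_def)
  have "\<sigma> ^ 4 + \<rho> ^ 4 \<le> (\<sigma>\<^sup>2 + \<rho>\<^sup>2)\<^sup>2"
    by (simp add: power2_sum)
  then have D: "\<sigma> ^ 4 + \<rho> ^ 4 \<le> \<delta>\<^sup>2"
    by (simp add: var)
  have "K * (24 * (\<sigma> ^ 4 + \<rho> ^ 4)) / \<theta> ^ 3 \<le> K * (24 * \<delta>\<^sup>2) / \<theta> ^ 3"
    using D pos by (intro divide_right_mono mult_left_mono) auto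
  then have e0: "e0 \<le> e"
    by (simp add: e0_def e_def a mult_ac)
  have "r0 \<le> 24 * \<delta>\<^sup>2 * (real K)\<^sup>2 / (a * K - L) ^ 3"
    unfolding r0_def using D L pos
    by (intro frac_le mult_mono power_mono) (auto simp: a)
  then have r0: "r0 \<le> r"
    by (simp add: r_def a power_mult_distrib)
  have rq: "\<rho> * q = c * sqrt (L / s)"
    using pos by (simp add: \<rho> q_def)
  have aq: "\<rho> / (a * q) = c / sqrt (L * s)"
  proof -
    have "s * sqrt (L / s) = sqrt (L * s)"
      using pos L_pos by (simp add: real_sqrt_divide real_sqrt_mult field_simps)
    moreover have "a * q = sqrt \<delta> * (s * sqrt (L / s))"
      using pos by (simp add: a q_def field_simps)
    ultimately show ?thesis
      using pos by (simp add: \<rho>)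
  qed
  have cL: "c / sqrt (L * s) * L = c * sqrt (L / s)"
    using pos L_pos by (simp add: real_sqrt_divide real_sqrt_mult field_simps)
  have "\<rho> / sqrt (2 * pi) * ((l + e0) / (a * q) + q) \<le> \<rho> / sqrt (2 * pi) * ((L + e) / (a * q) + q)"
    using e0 L a_pos q \<rho>_pos by (intro mult_left_mono add_right_mono divide_right_mono) auto
  also have "\<dots> = (\<rho> / (a * q) * (L + e) + \<rho> * q) / sqrt (2 * pi)"
    by (simp add: field_simps)
  also have "\<dots> = (c / sqrt (L * s) * L + c / sqrt (L * s) * e + c * sqrt (L / s)) / sqrt (2 * pi)"
    unfolding aq rq by (simp add: distrib_left)
  also have "\<dots> = c / sqrt (2 * pi) * (2 * sqrt (L / s) + e / sqrt (L * s))"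
    unfolding cL by (simp add: field_simps)
  finally have "a * expectation (\<lambda>\<omega>. \<bar>real (T \<omega>) - real (S \<omega>)\<bar>) \<le>
      c / sqrt (2 * pi) * (2 * sqrt (L / s) + e / sqrt (L * s)) + 3 * e + r"
    using expectation_passage_difference_le[OF pos(4) q, folded e0_def r0_def] L e0 r0 by (simp add: a)
  moreover have "\<bar>\<delta> * real (T \<omega>) - \<delta> * real (S \<omega>)\<bar> = \<delta> * \<bar>real (T \<omega>) - real (S \<omega>)\<bar>" for \<omega>
    using pos by (simp add: right_diff_distrib[symmetric] abs_mult)
  ultimately show ?thesis
    using pos by (simp add: a field_simps)
qed

lemma ennreal_le_liminf_liminf:
  fixes f :: "nat \<Rightarrow> nat \<Rightarrow> real"
  assumes "\<And>e. 0 < e \<Longrightarrow> \<forall>\<^sub>F m in sequentially. \<forall>\<^sub>F n in sequentially. D \<le> f m n + e"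
  shows "ennreal D \<le> liminf (\<lambda>m. liminf (\<lambda>n. ennreal (f m n)))"
proof (rule ennreal_le_epsilon)
  fix e :: real assume "0 < e"
  have "\<forall>\<^sub>F m in sequentially. ennreal (D - e) \<le> liminf (\<lambda>n. ennreal (f m n))"
    using assms[OF \<open>0 < e\<close>]
  proof eventually_elim
    case (elim m)
    then show ?case
      by (intro Liminf_bounded) (auto elim!: eventually_mono intro: ennreal_leI)
  qed
  then have "ennreal (D - e) \<le> liminf (\<lambda>m. liminf (\<lambda>n. ennreal (f m n)))"
    by (rule Liminf_bounded)
  \<comment> \<open>\<open>ennreal (D - e)\<close> is truncated to \<open>0\<close> when
    \<open>e\<close> exceeds \<open>D\<close>, hence the case distinction.\<close>
  moreover have "ennreal D \<le> ennreal (D - e) + ennreal e"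
    using \<open>0 < e\<close> by (cases "e \<le> D") (auto simp: ennreal_plus[symmetric] ennreal_leI add_increasing simp del: ennreal_plus)
  ultimately show "ennreal D \<le> liminf (\<lambda>m. liminf (\<lambda>n. ennreal (f m n))) + ennreal e"
    by (meson add_right_mono order_trans)
qed

lemma (in gaussian_walks) nn_integral_scaled_passage_difference:
  "(\<integral>\<^sup>+\<omega>. ennreal \<bar>\<delta> * real (T \<omega>) - \<delta> * real (S \<omega>)\<bar> \<partial>M) =
    ennreal (expectation (\<lambda>\<omega>. \<bar>\<delta> * real (T \<omega>) - \<delta> * real (S \<omega>)\<bar>))"
  using integrable_bounded_nat[OF measurable_T T_le] integrable_bounded_nat[OF measurable_S S_le]
  by (intro nn_integral_eq_integral) auto

lemma
  fixes B N :: "real \<Rightarrow> 'a \<Rightarrow> real" and \<epsilon> \<delta> s l :: real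
  assumes BN: "standard_wiener_process M B" "standard_wiener_process M N" "indep_processes M B N"
    and pos: "0 < \<epsilon>" "0 < \<delta>" "0 < s" "0 < l"
  shows gaussian_walks_increments: "gaussian_walks M
    (\<lambda>i \<omega>. (increment \<delta> B i \<omega> + \<epsilon> * increment \<delta> N i \<omega>) / (1 + \<epsilon>\<^sup>2))
    (\<lambda>i \<omega>. (\<epsilon>\<^sup>2 * increment \<delta> B i \<omega> - \<epsilon> * increment \<delta> N i \<omega>) / (1 + \<epsilon>\<^sup>2))
    K (s * \<delta>) (sqrt \<delta> / sqrt (1 + \<epsilon>\<^sup>2)) (\<epsilon> * sqrt \<delta> / sqrt (1 + \<epsilon>\<^sup>2)) l"
proof -
  interpret B: standard_wiener_process M B by fact
  have c: "0 < 1 + \<epsilon>\<^sup>2"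
    by (simp add: add_pos_nonneg)
  show ?thesis
    by unfold_locales (use BN pos c distributed_estimate_increment[OF BN pos(1,2)]
      distributed_error_increment[OF BN pos(1,2)] indep_estimate_error_increments[OF BN pos(1,2)] in auto)
qed

section \<open>Grid sums as sampled values of the processes\<close>

lemma sum_increment:
  "(\<Sum>i<k. increment \<delta> W i \<omega>) = W (real k * \<delta>) \<omega> - W 0 \<omega>"
  using sum_lessThan_telescope[of "\<lambda>i. W (real i * \<delta>) \<omega>" k] by (simp add: increment_def)

text \<open>The rotated parts add up to the increment of \<open>B\<close>, and both sums telescope.
  The zero starting values make the result agree with the separate clauses at time \<open>0\<close>,
  that is, for \<open>k = 0\<close>.\<close>

lemma
  assumes B0: "B 0 \<omega> = 0" and N0: "N 0 \<omega> = 0"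
  shows sum_signal_increments: "(\<Sum>i<k. s * \<delta> + (increment \<delta> B i \<omega> + \<epsilon> * increment \<delta> N i \<omega>) / (1 + \<epsilon>\<^sup>2) +
      (\<epsilon>\<^sup>2 * increment \<delta> B i \<omega> - \<epsilon> * increment \<delta> N i \<omega>) / (1 + \<epsilon>\<^sup>2)) = drifted_process s B (real k * \<delta>) \<omega>"
    and sum_estimate_increments: "(\<Sum>i<k. s * \<delta> + (increment \<delta> B i \<omega> + \<epsilon> * increment \<delta> N i \<omega>) / (1 + \<epsilon>\<^sup>2)) =
      estimated_process \<epsilon> s (noisy_process \<epsilon> (drifted_process s B) N) (real k * \<delta>) \<omega>"
proof -
  have c: "1 + \<epsilon>\<^sup>2 \<noteq> 0"
    by (metis add_pos_nonneg less_numeral_extra(1,3) zero_le_power2)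
  have "(\<Sum>i<k. s * \<delta> + (increment \<delta> B i \<omega> + \<epsilon> * increment \<delta> N i \<omega>) / (1 + \<epsilon>\<^sup>2) +
      (\<epsilon>\<^sup>2 * increment \<delta> B i \<omega> - \<epsilon> * increment \<delta> N i \<omega>) / (1 + \<epsilon>\<^sup>2)) = (\<Sum>i<k. s * \<delta> + increment \<delta> B i \<omega>)"
  proof (intro sum.cong refl)
    fix i
    have "(increment \<delta> B i \<omega> + \<epsilon> * increment \<delta> N i \<omega>) / (1 + \<epsilon>\<^sup>2) +
        (\<epsilon>\<^sup>2 * increment \<delta> B i \<omega> - \<epsilon> * increment \<delta> N i \<omega>) / (1 + \<epsilon>\<^sup>2) = (1 + \<epsilon>\<^sup>2) * increment \<delta> B i \<omega> / (1 + \<epsilon>\<^sup>2)"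
      by (simp add: add_divide_distrib[symmetric] algebra_simps)
    then show "s * \<delta> + (increment \<delta> B i \<omega> + \<epsilon> * increment \<delta> N i \<omega>) / (1 + \<epsilon>\<^sup>2) +
        (\<epsilon>\<^sup>2 * increment \<delta> B i \<omega> - \<epsilon> * increment \<delta> N i \<omega>) / (1 + \<epsilon>\<^sup>2) = s * \<delta> + increment \<delta> B i \<omega>"
      using c by (simp add: add.assoc)
  qed
  also have "\<dots> = drifted_process s B (real k * \<delta>) \<omega>"
    using B0 by (simp add: sum.distrib sum_increment drifted_process_def)
  finally show "(\<Sum>i<k. s * \<delta> + (increment \<delta> B i \<omega> + \<epsilon> * increment \<delta> N i \<omega>) / (1 + \<epsilon>\<^sup>2) +
      (\<epsilon>\<^sup>2 * increment \<delta> B i \<omega> - \<epsilon> * increment \<delta> N i \<omega>) / (1 + \<epsilon>\<^sup>2)) = drifted_process s B (real k * \<delta>) \<omega>" .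
  show "(\<Sum>i<k. s * \<delta> + (increment \<delta> B i \<omega> + \<epsilon> * increment \<delta> N i \<omega>) / (1 + \<epsilon>\<^sup>2)) =
      estimated_process \<epsilon> s (noisy_process \<epsilon> (drifted_process s B) N) (real k * \<delta>) \<omega>"
    using B0 N0
    by (simp add: sum.distrib sum_divide_distrib[symmetric] sum_distrib_left[symmetric] sum_increment
      estimated_process_def noisy_process_def drifted_process_def)
qed

lemma continuous_on_drifted_process:
  assumes "continuous_on {0..} (\<lambda>t. B t \<omega>)" "B 0 \<omega> = 0"
  shows "continuous_on {0..} (\<lambda>t. drifted_process s B t \<omega>)"
proof -
  have eq: "(\<lambda>t. drifted_process s B t \<omega>) = (\<lambda>t. B t \<omega> + s * t)"
    using assms(2) by (auto simp: drifted_process_def)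
  show ?thesis
    unfolding eq by (intro continuous_intros assms(1))
qed

lemma estimated_process_eq:
  assumes "B 0 \<omega> = 0" "N 0 \<omega> = 0"
  shows "estimated_process \<epsilon> s (noisy_process \<epsilon> (drifted_process s B) N) t \<omega> =
    s * t + (B t \<omega> + \<epsilon> * N t \<omega>) / (1 + \<epsilon>\<^sup>2)"
  using assms by (simp add: estimated_process_def noisy_process_def drifted_process_def)

lemma continuous_on_estimated_process:
  assumes "continuous_on {0..} (\<lambda>t. B t \<omega>)" "continuous_on {0..} (\<lambda>t. N t \<omega>)" "B 0 \<omega> = 0" "N 0 \<omega> = 0"
  shows "continuous_on {0..} (\<lambda>t. estimated_process \<epsilon> s (noisy_process \<epsilon> (drifted_process s B) N) t \<omega>)"
proof -
  have "1 + \<epsilon>\<^sup>2 \<noteq> 0"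
    by (metis add_pos_nonneg less_numeral_extra(1,3) zero_le_power2)
  then show ?thesis
    using assms by (auto simp: estimated_process_eq intro!: continuous_intros)
qed

theorem theorem2p4:
  fixes M :: "'a measure"
    and B N X Y Xhat :: "real \<Rightarrow> 'a \<Rightarrow> real"
    and \<epsilon> s l :: real
    and \<tau> \<eta> :: "'a \<Rightarrow> ereal"
  assumes "0 < \<epsilon>" and "0 < s" and "0 < l"
    and "standard_wiener_process M B"
    and "standard_wiener_process M N"
    and "indep_processes M B N"
  defines "X \<equiv> drifted_process s B"
    and "Y \<equiv> noisy_process \<epsilon> X N"
    and "Xhat \<equiv> estimated_process \<epsilon> s Y"
    and "\<tau> \<equiv> first_passage_time l X"
    and "\<eta> \<equiv> first_passage_time l Xhat"
  shows "(\<integral>\<^sup>+ \<omega>. e2ennreal \<bar>\<eta> \<omega> - \<tau> \<omega>\<bar> \<partial>M)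
    \<le> ennreal (sqrt (2 * l * \<epsilon>\<^sup>2 / (pi * (1 + \<epsilon>\<^sup>2) * s ^ 3))
        + sqrt (36 * \<epsilon>\<^sup>2 / ((1 + \<epsilon>\<^sup>2) * s\<^sup>2)) * (l / (2 * pi * s ^ 3)) powr (1 / 4))"
proof -
  note pos = \<open>0 < \<epsilon>\<close> \<open>0 < s\<close> \<open>0 < l\<close> and BN = assms(4-6)
  interpret B: standard_wiener_process M B by fact
  interpret N: standard_wiener_process M N by fact
  have c_pos: "0 < 1 + \<epsilon>\<^sup>2"
    by (simp add: add_pos_nonneg)
  \<comment> \<open>The horizon \<open>K * \<delta>\<close> tends to infinity, while the overshoot bound \<open>K * \<delta>\<^sup>2 / \<theta> ^ 3\<close> with
    \<open>\<theta> = 1 / (n + 1)\<close> tends to \<open>0\<close>. The level is lowered to \<open>l - a m\<close> because the grid passage times then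
    converge along every continuous path; at level \<open>l\<close> itself this would require that the path exceeds \<open>l\<close>
    immediately after reaching it.\<close>
  define \<delta> where "\<delta> n = 1 / (real n + 1) ^ 5" for n
  define K where "K n = (n + 1) ^ 6" for n :: nat
  define a where "a m = l / (real m + 2)" for m
  define c where "c = \<epsilon> / sqrt (1 + \<epsilon>\<^sup>2)"
  define U where "U n i \<omega> = (increment (\<delta> n) B i \<omega> + \<epsilon> * increment (\<delta> n) N i \<omega>) / (1 + \<epsilon>\<^sup>2)" for n i \<omega>
  define V where "V n i \<omega> = (\<epsilon>\<^sup>2 * increment (\<delta> n) B i \<omega> - \<epsilon> * increment (\<delta> n) N i \<omega>) / (1 + \<epsilon>\<^sup>2)" for n i \<omega>
  define est where "est n k \<omega> = (\<Sum>i<k. s * \<delta> n + U n i \<omega>)" for n k \<omega>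
  define sig where "sig n k \<omega> = (\<Sum>i<k. s * \<delta> n + U n i \<omega> + V n i \<omega>)" for n k \<omega>
  define f where "f m n \<omega> = \<bar>\<delta> n * real (capped_passage (l - a m) (K n) (\<lambda>k. est n k \<omega>)) -
    \<delta> n * real (capped_passage (l - a m) (K n) (\<lambda>k. sig n k \<omega>))\<bar>" for m n \<omega>
  \<comment> \<open>The last summand is of order
    \<open>(n + 1) ^ 6 * (n + 1) ^ 3 / (n + 1) ^ 10 = 1 / (n + 1)\<close>, and the first two vanish
    as well. Similarly \<open>r n\<close> is the square of the horizon over a cube of the same
    order.\<close>
  define e where "e n = s * \<delta> n + 1 / (real n + 1) + 24 * real (K n) * (\<delta> n)\<^sup>2 / (1 / (real n + 1)) ^ 3" for n
  define r where "r n = 24 * (\<delta> n * real (K n))\<^sup>2 / (s * \<delta> n * real (K n) - l) ^ 3" for n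
  define b where "b n = (c / sqrt (2 * pi) * (2 * sqrt (l / s) + e n / sqrt (l * s)) + 3 * e n + r n) / s" for n

  have \<delta>_pos: "0 < \<delta> n" for n
    by (simp add: \<delta>_def)
  have c: "0 < c"
    using pos c_pos by (simp add: c_def)
  have a: "0 < a m" "a m < l" for m
    using pos by (simp_all add: a_def field_simps add_pos_nonneg)
  have horizon: "\<delta> n * real (K n) = real n + 1" for n
  proof -
    have "x ^ 6 = x ^ 5 * x" for x :: real
      by (simp add: eval_nat_numeral)
    then have "real (K n) = (real n + 1) ^ 5 * (real n + 1)"
      by (simp add: K_def add.commute)
    moreover have "(real n + 1) ^ 5 \<noteq> 0"
      using of_nat_0_le_iff[of n, where 'a=real] by (auto simp del: of_nat_0_le_iff)
    ultimately show ?thesis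
      by (simp add: \<delta>_def)
  qed
  have walks: "gaussian_walks M (U n) (V n) (K n) (s * \<delta> n) (sqrt (\<delta> n) / sqrt (1 + \<epsilon>\<^sup>2))
      (\<epsilon> * sqrt (\<delta> n) / sqrt (1 + \<epsilon>\<^sup>2)) (l - a m)" for m n
    unfolding U_def[abs_def] V_def[abs_def]
    using gaussian_walks_increments[OF BN pos(1) \<delta>_pos pos(2)] a by simp

  have f_meas: "(\<lambda>\<omega>. ennreal (f m n \<omega>)) \<in> borel_measurable M" for m n
  proof -
    interpret g: gaussian_walks M "U n" "V n" "K n" "s * \<delta> n" "sqrt (\<delta> n) / sqrt (1 + \<epsilon>\<^sup>2)"
      "\<epsilon> * sqrt (\<delta> n) / sqrt (1 + \<epsilon>\<^sup>2)" "l - a m"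
      by (rule walks)
    have "f m n \<omega> = \<bar>\<delta> n * real (g.T \<omega>) - \<delta> n * real (g.S \<omega>)\<bar>" for \<omega>
      by (simp add: f_def g.T_def g.S_def g.estimate_def g.signal_def est_def sig_def)
    then show ?thesis
      by simp
  qed
  have f_le: "(\<integral>\<^sup>+\<omega>. ennreal (f m n \<omega>) \<partial>M) \<le> ennreal (b n)" if n: "l < s * (real n + 1)" for m n
  proof -
    interpret g: gaussian_walks M "U n" "V n" "K n" "s * \<delta> n" "sqrt (\<delta> n) / sqrt (1 + \<epsilon>\<^sup>2)"
      "\<epsilon> * sqrt (\<delta> n) / sqrt (1 + \<epsilon>\<^sup>2)" "l - a m"
      by (rule walks)
    have f_eq: "f m n \<omega> = \<bar>\<delta> n * real (g.T \<omega>) - \<delta> n * real (g.S \<omega>)\<bar>" for \<omega>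
      by (simp add: f_def g.T_def g.S_def g.estimate_def g.signal_def est_def sig_def)
    have var: "(sqrt (\<delta> n) / sqrt (1 + \<epsilon>\<^sup>2))\<^sup>2 + (\<epsilon> * sqrt (\<delta> n) / sqrt (1 + \<epsilon>\<^sup>2))\<^sup>2 = \<delta> n"
    proof -
      have "(sqrt (\<delta> n) / sqrt (1 + \<epsilon>\<^sup>2))\<^sup>2 + (\<epsilon> * sqrt (\<delta> n) / sqrt (1 + \<epsilon>\<^sup>2))\<^sup>2 = \<delta> n * (1 + \<epsilon>\<^sup>2) / (1 + \<epsilon>\<^sup>2)"
        using \<delta>_pos[of n] c_pos by (simp add: power_divide power_mult_distrib add_divide_distrib[symmetric] algebra_simps)
      then show ?thesis
        using c_pos by simp
    qed
    have "B.expectation (\<lambda>\<omega>. \<bar>\<delta> n * real (g.T \<omega>) - \<delta> n * real (g.S \<omega>)\<bar>) \<le> b n"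
      unfolding b_def e_def r_def
    \<comment> \<open>\<open>L = l\<close> dominates every level \<open>l - a m\<close>, so
      \<open>b n\<close> does not depend on \<open>m\<close>.\<close>
    proof (rule g.scaled_expectation_passage_difference_le[where c=c and L=l and \<theta>="1 / (real n + 1)" and s=s and \<delta>="\<delta> n"])
      show "l < s * \<delta> n * real (K n)"
        using n horizon[of n] by (simp add: mult.assoc)
    qed (use pos \<delta>_pos c var a(1)[of m] in \<open>auto simp: c_def\<close>)
    then show ?thesis
      unfolding f_eq g.nn_integral_scaled_passage_difference by (rule ennreal_leI)
  qed

  have b_lim: "b \<longlonglongrightarrow> sqrt (2 * l * \<epsilon>\<^sup>2 / (pi * (1 + \<epsilon>\<^sup>2) * s ^ 3))"
  proof -
    have K_eq: "real (K n) = (real n + 1) ^ 6" for n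
      by (simp add: K_def add.commute)
    have e: "e \<longlonglongrightarrow> 0"
      unfolding e_def \<delta>_def K_eq by real_asymp
    have "r = (\<lambda>n. 24 * (real n + 1)\<^sup>2 / (s * (real n + 1) - l) ^ 3)"
      by (rule ext) (simp add: r_def mult.assoc horizon)
    then have r: "r \<longlonglongrightarrow> 0"
      using pos by (simp, real_asymp)
    have "b \<longlonglongrightarrow> (c / sqrt (2 * pi) * (2 * sqrt (l / s) + 0 / sqrt (l * s)) + 3 * 0 + 0) / s"
      unfolding b_def using pos by (intro tendsto_intros e r) auto
    also have "(c / sqrt (2 * pi) * (2 * sqrt (l / s) + 0 / sqrt (l * s)) + 3 * 0 + 0) / s =
        sqrt (2 * l * \<epsilon>\<^sup>2 / (pi * (1 + \<epsilon>\<^sup>2) * s ^ 3))"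
    \<comment> \<open>The limit is nonnegative, so it suffices to compare squares: its square is
      \<open>4 * c\<^sup>2 * (l / s) / (2 * pi * s\<^sup>2)\<close>.\<close>
    proof (rule real_sqrt_unique[symmetric])
      have c2: "c\<^sup>2 = \<epsilon>\<^sup>2 / (1 + \<epsilon>\<^sup>2)"
        by (simp add: c_def power_divide)
      have "E / d * 4 * (l / s) / (2 * pi * s\<^sup>2) = 2 * l * E / (pi * d * s ^ 3)" if "0 < d" for d E :: real
        using pos that by (simp add: field_simps power2_eq_square power3_eq_cube)
      from this[OF c_pos, of "\<epsilon>\<^sup>2", folded c2]
      show "((c / sqrt (2 * pi) * (2 * sqrt (l / s) + 0 / sqrt (l * s)) + 3 * 0 + 0) / s)\<^sup>2 =
          2 * l * \<epsilon>\<^sup>2 / (pi * (1 + \<epsilon>\<^sup>2) * s ^ 3)"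
        using pos by (simp add: power_divide power_mult_distrib)
    qed (use c pos in auto)
    finally show ?thesis .
  qed

  have \<delta>_lim: "\<delta> \<longlonglongrightarrow> 0"
    unfolding \<delta>_def by real_asymp
  have K_lim: "filterlim (\<lambda>n. \<delta> n * real (K n)) at_top sequentially"
    unfolding horizon by real_asymp
  have a_lim: "a \<longlonglongrightarrow> 0"
    unfolding a_def using pos by real_asymp

  \<comment> \<open>With mesh \<open>real n\<close> the increment of index \<open>0\<close> is
    \<open>B n - B 0\<close>, so the laws of grid increments also supply the laws at integer
    times.\<close>
  have reach_X: "AE \<omega> in M. \<exists>n>0. l \<le> s * real n + increment (real n) B 0 \<omega>"
    using B.distributed_increment[of "real _" 0]
    by (intro B.AE_normal_with_drift_reaches[where \<sigma>=1]) (auto simp: pos)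
  have reach_Xhat: "AE \<omega> in M. \<exists>n>0. l \<le> s * real n +
      (increment (real n) B 0 \<omega> + \<epsilon> * increment (real n) N 0 \<omega>) / (1 + \<epsilon>\<^sup>2)"
    using distributed_estimate_increment[OF BN pos(1), of "real _" 0] c_pos
    by (intro B.AE_normal_with_drift_reaches[where \<sigma>="1 / sqrt (1 + \<epsilon>\<^sup>2)"]) (auto simp: pos)

  \<comment> \<open>Off a null set both passage times are finite and attained, so
    \<open>\<eta> \<omega> - \<tau> \<omega>\<close> is a difference of real numbers.\<close>
  have "AE \<omega> in M. e2ennreal \<bar>\<eta> \<omega> - \<tau> \<omega>\<bar> \<le> liminf (\<lambda>m. liminf (\<lambda>n. ennreal (f m n \<omega>)))"
    using B.start_at_zero N.start_at_zero B.continuous_paths N.continuous_paths reach_X reach_Xhat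
  proof eventually_elim
    case (elim \<omega>)
    have X_cont: "continuous_on {0..} (\<lambda>t. X t \<omega>)"
      using elim unfolding X_def by (intro continuous_on_drifted_process)
    have Xhat_cont: "continuous_on {0..} (\<lambda>t. Xhat t \<omega>)"
      using elim unfolding Xhat_def Y_def X_def by (intro continuous_on_estimated_process)
    from elim(5) obtain n where "0 < n" "l \<le> s * real n + increment (real n) B 0 \<omega>"
      by blast
    then have "l \<le> X (real n) \<omega>"
      using elim(1) by (simp add: X_def drifted_process_def increment_def add.commute)
    then have "\<exists>t\<ge>0. l \<le> X t \<omega>"
      by (intro exI[of _ "real n"]) simp
    then obtain t where t: "\<tau> \<omega> = ereal t" "0 \<le> t" "l \<le> X t \<omega>" "\<And>u. 0 \<le> u \<Longrightarrow> u < t \<Longrightarrow> X u \<omega> < l"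
      using first_passage_time_attained[where Z=X, OF X_cont] unfolding \<tau>_def by metis
    from elim(6) obtain n where "0 < n" "l \<le> s * real n +
        (increment (real n) B 0 \<omega> + \<epsilon> * increment (real n) N 0 \<omega>) / (1 + \<epsilon>\<^sup>2)"
      by blast
    then have "l \<le> Xhat (real n) \<omega>"
      using elim(1,2) by (simp add: Xhat_def Y_def X_def estimated_process_eq increment_def)
    then have "\<exists>t\<ge>0. l \<le> Xhat t \<omega>"
      by (intro exI[of _ "real n"]) simp
    then obtain h where h: "\<eta> \<omega> = ereal h" "0 \<le> h" "l \<le> Xhat h \<omega>" "\<And>u. 0 \<le> u \<Longrightarrow> u < h \<Longrightarrow> Xhat u \<omega> < l"
      using first_passage_time_attained[where Z=Xhat, OF Xhat_cont] unfolding \<eta>_def by metis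
    have est: "est n k \<omega> = Xhat (real k * \<delta> n) \<omega>" for n k
      unfolding est_def U_def Xhat_def Y_def X_def by (rule sum_estimate_increments[where B=B and N=N, OF elim(1,2)])
    have sig: "sig n k \<omega> = X (real k * \<delta> n) \<omega>" for n k
      unfolding sig_def U_def V_def X_def by (rule sum_signal_increments[where B=B and N=N, OF elim(1,2)])
    have "ennreal \<bar>h - t\<bar> \<le> liminf (\<lambda>m. liminf (\<lambda>n. ennreal (f m n \<omega>)))"
    proof (rule ennreal_le_liminf_liminf)
      fix e :: real assume "0 < e"
      then have "0 < e / 2"
        by simp
      have "\<forall>\<^sub>F m in sequentially. \<forall>\<^sub>F n in sequentially. \<bar>\<delta> n *
          real (capped_passage (l - a m) (K n) (\<lambda>k. Xhat (real k * \<delta> n) \<omega>)) - h\<bar> \<le> e / 2"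
        by (rule grid_passage_approx[OF Xhat_cont h(2,3) _ \<open>0 < e / 2\<close> \<delta>_pos \<delta>_lim K_lim a(1) a_lim]) (rule h(4))
      moreover
      have "\<forall>\<^sub>F m in sequentially. \<forall>\<^sub>F n in sequentially. \<bar>\<delta> n *
          real (capped_passage (l - a m) (K n) (\<lambda>k. X (real k * \<delta> n) \<omega>)) - t\<bar> \<le> e / 2"
        by (rule grid_passage_approx[OF X_cont t(2,3) _ \<open>0 < e / 2\<close> \<delta>_pos \<delta>_lim K_lim a(1) a_lim]) (rule t(4))
      ultimately
      show "\<forall>\<^sub>F m in sequentially. \<forall>\<^sub>F n in sequentially. \<bar>h - t\<bar> \<le> f m n \<omega> + e"
      proof eventually_elim
        case (elim m)
        then show ?case
        proof eventually_elim
          case (elim n)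
          then show ?case
            unfolding f_def est sig by linarith
        qed
      qed
    qed
    then show ?case
      by (simp add: t(1) h(1))
  qed
  then have "(\<integral>\<^sup>+ \<omega>. e2ennreal \<bar>\<eta> \<omega> - \<tau> \<omega>\<bar> \<partial>M) \<le> (\<integral>\<^sup>+ \<omega>. liminf (\<lambda>m. liminf (\<lambda>n. ennreal (f m n \<omega>))) \<partial>M)"
    by (rule nn_integral_mono_AE)
  \<comment> \<open>Fatou's lemma, once for each of the two limits. It asks for no dominating
    function, so bounds on the means at finite horizons suffice.\<close>
  also have "\<dots> \<le> liminf (\<lambda>m. \<integral>\<^sup>+ \<omega>. liminf (\<lambda>n. ennreal (f m n \<omega>)) \<partial>M)"
    by (intro nn_integral_liminf borel_measurable_liminf f_meas)
  also have "\<dots> \<le> liminf (\<lambda>m. liminf (\<lambda>n. \<integral>\<^sup>+ \<omega>. ennreal (f m n \<omega>) \<partial>M))"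
    by (intro Liminf_mono always_eventually allI nn_integral_liminf f_meas)
  also have "\<dots> \<le> liminf (\<lambda>m::nat. liminf (\<lambda>n. ennreal (b n)))"
  proof (rule Liminf_mono, rule always_eventually, rule allI, rule Liminf_mono)
    fix m
    have "filterlim (\<lambda>n. s * (real n + 1)) at_top sequentially"
      using pos by real_asymp
    then have "\<forall>\<^sub>F n in sequentially. l < s * (real n + 1)"
      by (simp add: filterlim_at_top_dense)
    then show "\<forall>\<^sub>F n in sequentially. (\<integral>\<^sup>+ \<omega>. ennreal (f m n \<omega>) \<partial>M) \<le> ennreal (b n)"
      by eventually_elim (rule f_le)
  qed
  also have "\<dots> = ennreal (sqrt (2 * l * \<epsilon>\<^sup>2 / (pi * (1 + \<epsilon>\<^sup>2) * s ^ 3)))"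
    using lim_imp_Liminf[OF _ tendsto_ennrealI[OF b_lim]] by (simp add: Liminf_const)
  also have "\<dots> \<le> ennreal (sqrt (2 * l * \<epsilon>\<^sup>2 / (pi * (1 + \<epsilon>\<^sup>2) * s ^ 3))
        + sqrt (36 * \<epsilon>\<^sup>2 / ((1 + \<epsilon>\<^sup>2) * s\<^sup>2)) * (l / (2 * pi * s ^ 3)) powr (1 / 4))"
    by (intro ennreal_leI) simp
  finally show ?thesis .
qed

end
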